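(* Let $\mu_0,\mu$ be integrable probability measures on $\mathbb{R}$ and let $(B_t)_{t\ge0}$ be a Brownian motion with $B_0\sim\mu_0$. Let $$C=\sup_{x\in\mathbb{R}}\{u_\mu(x)-u_{\mu_0}(x)\}.$$ Let $f_1,f_2,\ldots$ be a sequence of linear (i.e. affine) functions on $\mathbb{R}$ with $|f_n'(x)|\le1$ such that $$\inf_{n\in\mathbb{N}}f_n(x)\wedge u_{\mu_0}(x)=u_\mu(x)-C\quad\text{for all }x\in\mathbb{R}.$$ Set $T_0=0$, $g_0(x)=u_{\mu_0}(x)$ and, for $n\ge1$, $$a_n=\inf\{x\in\mathbb{R}:f_n(x)<g_{n-1}(x)\},\qquad b_n=\sup\{x\in\mathbb{R}:f_n(x)<g_{n-1}(x)\},$$ $$T_n=\inf\{t\ge T_{n-1}:B_t\notin(a_n,b_n)\},\qquad g_n(x)=g_{n-1}(x)\wedge f_n(x),$$ and let $T=\lim_{n\to\infty}T_n$. Then $T$ is minimal.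
   Context: $B$ is a one-dimensional Brownian motion with respect to a filtration; stopping times are with respect to this filtration. A measure $\mu$ is integrable if $\int|x|\,\mu(dx)<\infty$. For an integrable probability measure $\mu$ on $\mathbb{R}$, its potential is $u_\mu(x)=-\int|x-y|\,\mu(dy)$. Minimality: a stopping time $T$ is minimal (for $B$) if whenever $S\le T$ is a stopping time such that $B_S$ and $B_T$ have the same distribution, then $S=T$ a.s. Conventions: $\inf\emptyset=+\infty$, $\sup\emptyset=-\infty$, and $(a,b)=\emptyset$ if $a\ge b$ (so $T_n=T_{n-1}$ when $f_n\ge g_{n-1}$ everywhere); $a_n=-\infty$ or $b_n=+\infty$ is allowed. The sequence $T_n$ is increasing, and $T$ is a.s. finite with $B_T\sim\mu$. *)

theory Defs
  imports "HOL-Probability.Probability"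
begin

text \<open>
  Time is indexed by \<^typ>\<open>ennreal\<close> in the filtration so that stopping times may take the value
  \<open>\<infinity>\<close>. The last member \<open>F \<infinity>\<close> is an arbitrary \<open>\<sigma>\<close>-algebra between all \<open>F t\<close> and
  \<open>sets M\<close>; it puts no constraint on stopping times. The usual conditions are not assumed, and
  all paths are continuous, so exit times of open intervals are stopping times nevertheless.
  The process itself is used only at real times \<open>t \<ge> 0\<close>.
\<close>

locale brownian_motion = prob_space M + filtration "space M" F
  for M :: "'a measure" and F :: "ennreal \<Rightarrow> 'a measure" +
  fixes B :: "real \<Rightarrow> 'a \<Rightarrow> real"
  assumes sets_F_subset: "\<And>t. sets (F t) \<subseteq> sets M"
    and adapted: "\<And>t. 0 \<le> t \<Longrightarrow> B t \<in> borel_measurable (F (ennreal t))"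
    and gaussian_increments: "\<And>s t. 0 \<le> s \<Longrightarrow> s < t \<Longrightarrow>
      distributed M lborel (\<lambda>\<omega>. B t \<omega> - B s \<omega>) (normal_density 0 (sqrt (t - s)))"
    and independent_increments: "\<And>s t. 0 \<le> s \<Longrightarrow> s < t \<Longrightarrow>
      indep_set (sets (F (ennreal s)))
        {(\<lambda>\<omega>. B t \<omega> - B s \<omega>) -` A \<inter> space M | A. A \<in> sets borel}"
    and continuous_paths: "\<And>\<omega>. \<omega> \<in> space M \<Longrightarrow> continuous_on {0..} (\<lambda>t. B t \<omega>)"

text \<open>On \<open>{T = \<infinity>}\<close> the value below is \<open>B 0\<close>, since \<open>enn2real \<infinity> = 0\<close>; it is used
  only for almost surely finite \<open>T\<close>.\<close>

definition stopped_value :: "(real \<Rightarrow> 'a \<Rightarrow> real) \<Rightarrow> ('a \<Rightarrow> ennreal) \<Rightarrow> 'a \<Rightarrow> real" where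
  "stopped_value B T \<omega> = B (enn2real (T \<omega>)) \<omega>"

text \<open>Almost sure finiteness of \<open>T\<close> is part of the notion, as the law of \<open>B\<close> at time \<open>T\<close> is
  meaningless otherwise. It carries over to every competitor \<open>S\<close>.\<close>

definition minimal_stopping_time ::
  "'a measure \<Rightarrow> (ennreal \<Rightarrow> 'a measure) \<Rightarrow> (real \<Rightarrow> 'a \<Rightarrow> real) \<Rightarrow> ('a \<Rightarrow> ennreal) \<Rightarrow> bool" where
  "minimal_stopping_time M F B T \<longleftrightarrow>
     stopping_time F T \<and> (AE \<omega> in M. T \<omega> < \<infinity>) \<and>
     (\<forall>S. stopping_time F S \<and> (AE \<omega> in M. S \<omega> \<le> T \<omega>) \<and>
          distr M borel (stopped_value B S) = distr M borel (stopped_value B T)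
        \<longrightarrow> (AE \<omega> in M. S \<omega> = T \<omega>))"

definition potential :: "real measure \<Rightarrow> real \<Rightarrow> real" where
  "potential \<mu> x = - (\<integral>y. \<bar>x - y\<bar> \<partial>\<mu>)"

text \<open>The sequence of functions is indexed from 1; \<open>f 0\<close> is never used.\<close>

primrec cw_g :: "real measure \<Rightarrow> (nat \<Rightarrow> real \<Rightarrow> real) \<Rightarrow> nat \<Rightarrow> real \<Rightarrow> real" where
  "cw_g \<mu>0 f 0 = potential \<mu>0"
| "cw_g \<mu>0 f (Suc n) = (\<lambda>x. min (cw_g \<mu>0 f n x) (f (Suc n) x))"

text \<open>The endpoints are extended reals, so \<open>Inf {} = \<infinity>\<close> and \<open>Sup {} = -\<infinity>\<close>. They are meant
  for \<open>n \<ge> 1\<close>.\<close>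

definition cw_a :: "real measure \<Rightarrow> (nat \<Rightarrow> real \<Rightarrow> real) \<Rightarrow> nat \<Rightarrow> ereal" where
  "cw_a \<mu>0 f n = Inf (ereal ` {x. f n x < cw_g \<mu>0 f (n - 1) x})"

definition cw_b :: "real measure \<Rightarrow> (nat \<Rightarrow> real \<Rightarrow> real) \<Rightarrow> nat \<Rightarrow> ereal" where
  "cw_b \<mu>0 f n = Sup (ereal ` {x. f n x < cw_g \<mu>0 f (n - 1) x})"

primrec cw_T :: "real measure \<Rightarrow> (nat \<Rightarrow> real \<Rightarrow> real) \<Rightarrow> (real \<Rightarrow> 'a \<Rightarrow> real) \<Rightarrow> nat \<Rightarrow> 'a \<Rightarrow> ennreal"
where
  "cw_T \<mu>0 f B 0 = (\<lambda>\<omega>. 0)"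
| "cw_T \<mu>0 f B (Suc n) = (\<lambda>\<omega>. Inf {ennreal t | t. 0 \<le> t \<and> cw_T \<mu>0 f B n \<omega> \<le> ennreal t \<and>
      ereal (B t \<omega>) \<notin> {cw_a \<mu>0 f (Suc n) <..< cw_b \<mu>0 f (Suc n)}})"

end

theory Submission
  imports Defs
begin

text \<open>
  Up to a bounded time \<open>N\<close> the functions \<open>cw_g\<close> control the potentials of the stopped process:
  by induction on \<open>n\<close>, the mean of \<open>\<bar>B - z\<bar>\<close> at time \<open>T\<^sub>n \<and> N\<close> is at most \<open>- cw_g n z\<close>. For \<open>z\<close> outside
  \<open>(a\<^sub>n, b\<^sub>n)\<close> the function \<open>\<bar>x - z\<bar>\<close> is affine along the path between \<open>T\<^sub>n\<^sub>-\<^sub>1\<close> and \<open>T\<^sub>n\<close>, and inside the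
  bound follows from convexity in \<open>z\<close>; an infinite endpoint forces the slope of \<open>f\<^sub>n\<close> to be \<open>\<plusminus>1\<close>.
  Hence \<open>E \<bar>B - z\<bar>\<close> grows between times \<open>0\<close> and \<open>T \<and> N\<close> by at most
  \<open>C - (potential \<mu> z - potential \<mu>0 z)\<close>, which is arbitrarily small for suitable \<open>z\<close>, by the choice of \<open>C\<close>.

  Suppose that \<open>S \<le> T\<close> and \<open>B\<^sub>S\<close> has the law of \<open>B\<^sub>T\<close>. Since \<open>sqrt (1 + x\<^sup>2) - \<bar>x - z\<bar>\<close> is bounded, its means
  at \<open>S \<and> N\<close> and \<open>T \<and> N\<close> have the same limit, so in the limit the mean of the strictly convex
  function \<open>sqrt (1 + x\<^sup>2)\<close> increases from \<open>S \<and> N\<close> to \<open>T \<and> N\<close> by no more than that of \<open>\<bar>x - z\<bar>\<close>, that is,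
  by an arbitrarily small amount. This is impossible if \<open>S < T\<close> with positive probability.
\<close>

section \<open>Convergence of expectations\<close>

text \<open>Fatou's lemma in Bochner form. It carries upper bounds on means through limits where no
  dominating function is at hand.\<close>

lemma integral_le_of_tendsto:
  fixes Y :: "nat \<Rightarrow> 'b \<Rightarrow> real"
  assumes "\<And>k. integrable M (Y k)" "\<And>k \<omega>. \<omega> \<in> space M \<Longrightarrow> 0 \<le> Y k \<omega>"
    and lim: "\<And>\<omega>. \<omega> \<in> space M \<Longrightarrow> (\<lambda>k. Y k \<omega>) \<longlonglongrightarrow> Z \<omega>"
    and bd: "\<And>k. (\<integral>\<omega>. Y k \<omega> \<partial>M) \<le> K"
  shows "integrable M Z" "(\<integral>\<omega>. Z \<omega> \<partial>M) \<le> K"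
proof -
  have [measurable]: "Y k \<in> borel_measurable M" for k using assms(1) by blast
  have mZ[measurable]: "Z \<in> borel_measurable M"
    by (rule borel_measurable_LIMSEQ_real[OF lim]) auto
  have Z0: "\<omega> \<in> space M \<Longrightarrow> 0 \<le> Z \<omega>" for \<omega>
    by (rule LIMSEQ_le_const[OF lim]) (auto intro!: exI[of _ 0] assms(2))
  have K0: "0 \<le> K"
    using order_trans[OF Bochner_Integration.integral_nonneg bd[of 0]] assms(2) by blast
  have "(\<integral>\<^sup>+ \<omega>. ennreal (Z \<omega>) \<partial>M) = (\<integral>\<^sup>+ \<omega>. liminf (\<lambda>k. ennreal (Y k \<omega>)) \<partial>M)"
    by (intro nn_integral_cong lim_imp_Liminf[symmetric] tendsto_ennrealI lim) auto
  also have "\<dots> \<le> liminf (\<lambda>k. \<integral>\<^sup>+ \<omega>. ennreal (Y k \<omega>) \<partial>M)"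
    by (rule nn_integral_liminf) auto
  also have "\<dots> \<le> liminf (\<lambda>k. ennreal K)"
    using assms(1,2) bd by (intro Liminf_mono always_eventually allI)
      (subst nn_integral_eq_integral, auto intro!: ennreal_leI)
  finally have *: "(\<integral>\<^sup>+ \<omega>. ennreal (Z \<omega>) \<partial>M) \<le> ennreal K"
    by (simp add: Liminf_const)
  then show int: "integrable M Z"
    using Z0 by (intro integrableI_nonneg) (auto simp: less_top[symmetric] top_unique)
  show "(\<integral>\<omega>. Z \<omega> \<partial>M) \<le> K"
    using * int Z0 K0 by (subst (asm) nn_integral_eq_integral) (auto simp: ennreal_le_iff)
qed

text \<open>A bound in L2 gives uniform integrability, so pointwise convergence implies convergence
  in L1.\<close>

lemma (in prob_space) integral_tendsto_of_L2_bounded: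
  fixes Y :: "nat \<Rightarrow> 'a \<Rightarrow> real"
  assumes [measurable]: "\<And>k. Y k \<in> borel_measurable M"
    and int: "\<And>k. integrable M (\<lambda>\<omega>. (Y k \<omega>)\<^sup>2)"
    and lim: "\<And>\<omega>. \<omega> \<in> space M \<Longrightarrow> (\<lambda>k. Y k \<omega>) \<longlonglongrightarrow> Z \<omega>"
    and bd: "\<And>k. expectation (\<lambda>\<omega>. (Y k \<omega>)\<^sup>2) \<le> K"
  shows "integrable M Z" "(\<lambda>k. expectation (Y k)) \<longlonglongrightarrow> expectation Z"
proof -
  have [measurable]: "Z \<in> borel_measurable M"
    by (rule borel_measurable_LIMSEQ_real[OF lim]) auto
  have Z2: "integrable M (\<lambda>\<omega>. (Z \<omega>)\<^sup>2)" "expectation (\<lambda>\<omega>. (Z \<omega>)\<^sup>2) \<le> K"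
    by (rule integral_le_of_tendsto[OF int]; auto intro!: tendsto_intros lim bd)+
  show Z1: "integrable M Z" by (rule square_integrable_imp_integrable) (auto intro: Z2)
  have Y1: "integrable M (Y k)" for k
    by (rule square_integrable_imp_integrable) (auto intro: int)
  have sq: "(Y k \<omega> - Z \<omega>)\<^sup>2 \<le> 2 * (Y k \<omega>)\<^sup>2 + 2 * (Z \<omega>)\<^sup>2" for k \<omega>
    using zero_le_power2[of "Y k \<omega> + Z \<omega>"] by (simp add: power2_eq_square algebra_simps)
  have D2: "integrable M (\<lambda>\<omega>. (Y k \<omega> - Z \<omega>)\<^sup>2)" for k
    by (rule Bochner_Integration.integrable_bound[of _ "\<lambda>\<omega>. 2 * (Y k \<omega>)\<^sup>2 + 2 * (Z \<omega>)\<^sup>2"])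
      (use sq int Z2 in auto)
  have D2_le: "expectation (\<lambda>\<omega>. (Y k \<omega> - Z \<omega>)\<^sup>2) \<le> 4 * K" for k
  proof -
    have "expectation (\<lambda>\<omega>. (Y k \<omega> - Z \<omega>)\<^sup>2) \<le> expectation (\<lambda>\<omega>. 2 * (Y k \<omega>)\<^sup>2 + 2 * (Z \<omega>)\<^sup>2)"
      by (rule integral_mono) (use D2 sq int Z2 in auto)
    also have "\<dots> = 2 * expectation (\<lambda>\<omega>. (Y k \<omega>)\<^sup>2) + 2 * expectation (\<lambda>\<omega>. (Z \<omega>)\<^sup>2)"
      using int Z2 by simp
    finally show ?thesis using bd[of k] Z2 by simp
  qed
  show "(\<lambda>k. expectation (Y k)) \<longlonglongrightarrow> expectation Z"
  proof (rule LIMSEQ_I)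
    fix e :: real assume e: "0 < e"
    have K0: "0 \<le> K" using order_trans[OF Bochner_Integration.integral_nonneg Z2(2)] by auto
    \<comment> \<open>Truncation level: below \<open>R\<close> the difference
      \<open>\<bar>Y k - Z\<bar>\<close> is handled by dominated convergence, and the part above
      \<open>R\<close> has mean at most \<open>4 * K / R\<close>, which this choice makes less than
      \<open>e / 2\<close>. The summand 1 keeps \<open>R\<close> positive if
      \<open>K = 0\<close>.\<close>
    define R where "R = (8 * K + 1) / e"
    have R: "0 < R" "4 * K / R < e / 2" using e K0 by (auto simp: R_def field_simps)
    have "(\<lambda>k. expectation (\<lambda>\<omega>. min \<bar>Y k \<omega> - Z \<omega>\<bar> R)) \<longlonglongrightarrow> expectation (\<lambda>\<omega>. 0)"
    proof (rule integral_dominated_convergence[where w = "\<lambda>_. R"])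
      have "(\<lambda>k. min \<bar>Y k \<omega> - Z \<omega>\<bar> R) \<longlonglongrightarrow> 0" if "\<omega> \<in> space M" for \<omega>
      proof -
        have "(\<lambda>k. min \<bar>Y k \<omega> - Z \<omega>\<bar> R) \<longlonglongrightarrow> min \<bar>Z \<omega> - Z \<omega>\<bar> R"
          by (intro tendsto_intros lim that)
        with R show ?thesis by simp
      qed
      then show "AE \<omega> in M. (\<lambda>k. min \<bar>Y k \<omega> - Z \<omega>\<bar> R) \<longlonglongrightarrow> 0" by auto
    qed (use R in auto)
    then have "(\<lambda>k. expectation (\<lambda>\<omega>. min \<bar>Y k \<omega> - Z \<omega>\<bar> R)) \<longlonglongrightarrow> 0" by simp
    from LIMSEQ_D[OF this, of "e/2"] e obtain k0 where
      k0: "\<And>k. k \<ge> k0 \<Longrightarrow> \<bar>expectation (\<lambda>\<omega>. min \<bar>Y k \<omega> - Z \<omega>\<bar> R)\<bar> < e / 2" by auto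
    have "norm (expectation (Y k) - expectation Z) < e" if "k \<ge> k0" for k
    proof -
      have im: "integrable M (\<lambda>\<omega>. min \<bar>Y k \<omega> - Z \<omega>\<bar> R)"
        by (rule Bochner_Integration.integrable_bound[of _ "\<lambda>_. R"]) (use R in auto)
      have "\<bar>expectation (Y k) - expectation Z\<bar> = \<bar>expectation (\<lambda>\<omega>. Y k \<omega> - Z \<omega>)\<bar>"
        using Y1 Z1 by simp
      also have "\<dots> \<le> expectation (\<lambda>\<omega>. \<bar>Y k \<omega> - Z \<omega>\<bar>)" by simp
      also have "\<dots> \<le> expectation (\<lambda>\<omega>. min \<bar>Y k \<omega> - Z \<omega>\<bar> R + (Y k \<omega> - Z \<omega>)\<^sup>2 / R)"
      proof (rule integral_mono)
        fix \<omega>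
        have "\<bar>Y k \<omega> - Z \<omega>\<bar> \<le> (Y k \<omega> - Z \<omega>)\<^sup>2 / R" if "R \<le> \<bar>Y k \<omega> - Z \<omega>\<bar>"
        proof -
          have "R * \<bar>Y k \<omega> - Z \<omega>\<bar> \<le> \<bar>Y k \<omega> - Z \<omega>\<bar> * \<bar>Y k \<omega> - Z \<omega>\<bar>"
            by (rule mult_right_mono[OF that]) auto
          then show ?thesis using R by (simp add: field_simps power2_eq_square)
        qed
        then show "\<bar>Y k \<omega> - Z \<omega>\<bar> \<le> min \<bar>Y k \<omega> - Z \<omega>\<bar> R + (Y k \<omega> - Z \<omega>)\<^sup>2 / R"
          using R by (auto simp: min_def)
      qed (use Y1 Z1 im D2 in auto)
      also have "\<dots> = expectation (\<lambda>\<omega>. min \<bar>Y k \<omega> - Z \<omega>\<bar> R) + expectation (\<lambda>\<omega>. (Y k \<omega> - Z \<omega>)\<^sup>2) / R"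
        using im D2 by simp
      also have "\<dots> < e / 2 + e / 2"
        using k0[OF that] R D2_le[of k] divide_right_mono[OF D2_le[of k], of R] by linarith
      finally show ?thesis by simp
    qed
    then show "\<exists>no. \<forall>n\<ge>no. norm (expectation (Y n) - expectation Z) < e" by blast
  qed
qed

section \<open>Brownian motion stopped on a grid\<close>

context brownian_motion
begin

lemma subalgebra_F: "subalgebra M (F t)"
  unfolding subalgebra_def using space_F sets_F_subset by auto

lemma measurable_F: "Y \<in> borel_measurable (F s) \<Longrightarrow> s \<le> t \<Longrightarrow> Y \<in> borel_measurable (F t)"
  by (rule measurable_from_subalg[of "F t" "F s"]) (auto simp: subalgebra_def space_F dest: sets_F_mono)

lemma measurable_F_M: "Y \<in> borel_measurable (F s) \<Longrightarrow> Y \<in> borel_measurable M"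
  using measurable_from_subalg[OF subalgebra_F] .

lemma measurable_B: "0 \<le> t \<Longrightarrow> B t \<in> borel_measurable M"
  using adapted measurable_F_M by blast

lemma increment_moments:
  assumes st: "0 \<le> s" "s < t"
  shows "integrable M (\<lambda>\<omega>. (B t \<omega> - B s \<omega>) ^ p)"
    and "expectation (\<lambda>\<omega>. B t \<omega> - B s \<omega>) = 0"
    and "expectation (\<lambda>\<omega>. (B t \<omega> - B s \<omega>)\<^sup>2) = t - s"
    and "expectation (\<lambda>\<omega>. (B t \<omega> - B s \<omega>) ^ 4) = 3 * (t - s)\<^sup>2"
proof -
  note D = gaussian_increments[OF st]
  have sig: "0 < sqrt (t - s)" using st by simp
  show "integrable M (\<lambda>\<omega>. (B t \<omega> - B s \<omega>) ^ p)"
    by (subst distributed_integrable[OF D, symmetric])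
      (use integrable_normal_moment[OF sig, of 0 p] in auto)
  have "expectation (\<lambda>\<omega>. (B t \<omega> - B s \<omega>) ^ p)
      = (\<integral>x. normal_density 0 (sqrt (t - s)) x * (x - 0) ^ p \<partial>lborel)" for p
    by (subst distributed_integral[OF D, symmetric]) auto
  from this[of 1] this[of 2] this[of 4]
    integral_normal_moment_odd[OF sig, of 0 0] integral_normal_moment_even[OF sig, of 0 1]
    integral_normal_moment_even[OF sig, of 0 2]
  show "expectation (\<lambda>\<omega>. B t \<omega> - B s \<omega>) = 0"
    and "expectation (\<lambda>\<omega>. (B t \<omega> - B s \<omega>)\<^sup>2) = t - s"
    and "expectation (\<lambda>\<omega>. (B t \<omega> - B s \<omega>) ^ 4) = 3 * (t - s)\<^sup>2"
    using st by (auto simp: fact_numeral field_simps power2_eq_square)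
qed

lemma increment_independent:
  assumes st: "0 \<le> s" "s < t" and Y: "Y \<in> borel_measurable (F (ennreal s))" "integrable M Y"
  shows "integrable M (\<lambda>\<omega>. Y \<omega> * (B t \<omega> - B s \<omega>) ^ p)"
    and "expectation (\<lambda>\<omega>. Y \<omega> * (B t \<omega> - B s \<omega>) ^ p)
      = expectation Y * expectation (\<lambda>\<omega>. (B t \<omega> - B s \<omega>) ^ p)"
proof -
  let ?D = "\<lambda>\<omega>. B t \<omega> - B s \<omega>"
  have [measurable]: "Y \<in> borel_measurable M" "?D \<in> borel_measurable M"
    using Y measurable_F_M measurable_B st by auto
  \<comment> \<open>Since \<open>Y\<close> is measurable for \<open>F s\<close>, its preimages
    belong to \<open>F s\<close>, and independence passes to smaller families.\<close>
  have set: "indep_set {Y -` A \<inter> space M | A. A \<in> sets borel} {?D -` A \<inter> space M | A. A \<in> sets borel}"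
    using independent_increments[OF st] unfolding indep_set_def
    by (rule indep_sets_mono_sets) (use Y(1) in \<open>auto simp: measurable_def space_F split: bool.splits\<close>)
  \<comment> \<open>\<open>indep_var_eq\<close> speaks of the generated \<sigma>-algebras;
    independence extends to these from families closed under intersection.\<close>
  have "Int_stable {X -` A \<inter> space M | A. A \<in> sets (borel::real measure)}" for X :: "'a \<Rightarrow> real"
  proof (safe intro!: Int_stableI)
    fix A A' :: "real set" assume "A \<in> sets borel" "A' \<in> sets borel"
    then show "\<exists>Aa. X -` A \<inter> space M \<inter> (X -` A' \<inter> space M) = X -` Aa \<inter> space M \<and> Aa \<in> sets borel"
      by (intro exI[of _ "A \<inter> A'"]) auto
  qed
  with set have "indep_var borel Y borel ?D"
    unfolding indep_var_eq by (intro conjI indep_set_sigma_sets) auto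
  from indep_var_compose[OF this, of id borel "\<lambda>x. x ^ p" borel]
  have ind: "indep_var borel Y borel (\<lambda>\<omega>. (?D \<omega>) ^ p)" by (simp add: comp_def)
  show "integrable M (\<lambda>\<omega>. Y \<omega> * ?D \<omega> ^ p)"
    by (rule indep_var_integrable[OF ind Y(2) increment_moments(1)[OF st]])
  show "expectation (\<lambda>\<omega>. Y \<omega> * ?D \<omega> ^ p) = expectation Y * expectation (\<lambda>\<omega>. ?D \<omega> ^ p)"
    by (rule indep_var_lebesgue_integral[OF ind Y(2) increment_moments(1)[OF st]])
qed

text \<open>The value of \<open>B\<close> at the first multiple of \<open>h\<close> that is at least
  \<open>T\<close>, or at \<open>n * h\<close> if that comes first. The recursion exhibits each step
  as an increment of \<open>B\<close> on the event \<open>n * h < T\<close>, which belongs to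
  \<open>F (n * h)\<close>, so independence of increments does the work of optional
  stopping.\<close>

primrec grid_stop :: "real \<Rightarrow> ('a \<Rightarrow> ennreal) \<Rightarrow> nat \<Rightarrow> 'a \<Rightarrow> real" where
  "grid_stop h T 0 = B 0"
| "grid_stop h T (Suc n) = (\<lambda>\<omega>. if ennreal (real n * h) < T \<omega> then B (real (Suc n) * h) \<omega>
     else grid_stop h T n \<omega>)"

lemma grid_stop_before:
  assumes "0 \<le> h" "ennreal (real n * h) < T \<omega>"
  shows "grid_stop h T n \<omega> = B (real n * h) \<omega>"
proof (cases n)
  case (Suc m)
  have "ennreal (real m * h) \<le> ennreal (real n * h)"
    using assms(1) Suc by (intro ennreal_leI mult_right_mono) auto
  then have "ennreal (real m * h) < T \<omega>" using assms(2) by (rule le_less_trans)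
  with Suc show ?thesis by simp
qed simp

text \<open>Rounding \<open>T\<close> up to the grid overshoots by at most one step; with continuous
  paths this identifies the limit as \<open>h\<close> tends to 0.\<close>

lemma grid_stop_time:
  assumes h: "0 < h"
  shows "\<exists>s. grid_stop h T n \<omega> = B s \<omega> \<and> enn2real (min (T \<omega>) (ennreal (real n * h))) \<le> s
    \<and> s \<le> enn2real (min (T \<omega>) (ennreal (real n * h))) + h"
proof (induction n)
  case 0
  then show ?case using h by (auto intro!: exI[of _ 0] simp: min_def)
next
  case (Suc n)
  show ?case
  proof (cases "ennreal (real n * h) < T \<omega>")
    case True
    have "enn2real (min (T \<omega>) (ennreal (real (Suc n) * h))) \<le> real (Suc n) * h"
      using h by (intro enn2real_leI) auto
    moreover have "real n * h \<le> enn2real (min (T \<omega>) (ennreal (real (Suc n) * h)))"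
    proof -
      have "ennreal (real n * h) \<le> min (T \<omega>) (ennreal (real (Suc n) * h))"
        using True h by (auto intro!: ennreal_leI mult_right_mono)
      from enn2real_mono[OF this] show ?thesis
        using h by (auto simp: min_less_iff_disj)
    qed
    moreover have "real (Suc n) * h = real n * h + h" by (simp add: ring_distribs)
    ultimately show ?thesis using True
      by (intro exI[of _ "real (Suc n) * h"] conjI) (simp, assumption, linarith)
  next
    case False
    then have le: "T \<omega> \<le> ennreal (real n * h)" by simp
    moreover have "ennreal (real n * h) \<le> ennreal (real (Suc n) * h)"
      using h by (intro ennreal_leI mult_right_mono) auto
    ultimately have "min (T \<omega>) (ennreal (real (Suc n) * h)) = min (T \<omega>) (ennreal (real n * h))"
      by (auto simp: min_def)
    with Suc False show ?thesis by simp
  qed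
qed

lemma pred_F_mono: "Measurable.pred (F s) P \<Longrightarrow> s \<le> t \<Longrightarrow> Measurable.pred (F t) P"
  using sets_F_mono[of s t] by (auto simp: pred_def space_F)

lemma pred_F_M: "Measurable.pred (F s) P \<Longrightarrow> Measurable.pred M P"
  using sets_F_subset[of s] by (auto simp: pred_def space_F)

lemma measurable_grid_stop:
  assumes "stopping_time F T" "0 < h"
  shows "grid_stop h T n \<in> borel_measurable (F (ennreal (real n * h)))"
proof (induction n)
  case 0
  then show ?case using adapted[of 0] by simp
next
  case (Suc n)
  have le: "ennreal (real n * h) \<le> ennreal (real (Suc n) * h)"
    using assms(2) by (intro ennreal_leI mult_right_mono) auto
  have [measurable]: "Measurable.pred (F (ennreal (real (Suc n) * h))) (\<lambda>\<omega>. ennreal (real n * h) < T \<omega>)"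
    by (rule pred_F_mono[OF stopping_timeD2[OF assms(1)] le])
  have [measurable]: "grid_stop h T n \<in> borel_measurable (F (ennreal (real (Suc n) * h)))"
    by (rule measurable_F[OF Suc le])
  have [measurable]: "B (real (Suc n) * h) \<in> borel_measurable (F (ennreal (real (Suc n) * h)))"
    using assms(2) by (intro adapted) auto
  show ?case unfolding grid_stop.simps by measurable
qed

end

locale integrable_brownian_motion = brownian_motion +
  assumes integrable_B0: "integrable M (B 0)"
begin

lemma integrable_B: "0 \<le> t \<Longrightarrow> integrable M (B t)"
proof (cases "t = 0")
  case False
  assume "0 \<le> t"
  then have "integrable M (\<lambda>\<omega>. (B t \<omega> - B 0 \<omega>) ^ 1)"
    using False by (intro increment_moments) auto
  from Bochner_Integration.integrable_add[OF this integrable_B0] show ?thesis by simp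
qed (simp add: integrable_B0)

lemma integrable_grid_stop:
  assumes "stopping_time F T" "0 < h"
  shows "integrable M (grid_stop h T n)"
proof (induction n)
  case 0
  then show ?case by (simp add: integrable_B0)
next
  case (Suc n)
  show ?case
  proof (rule Bochner_Integration.integrable_bound)
    show "integrable M (\<lambda>\<omega>. \<bar>B (real (Suc n) * h) \<omega>\<bar> + \<bar>grid_stop h T n \<omega>\<bar>)"
      using Suc assms(2) by (intro Bochner_Integration.integrable_add integrable_abs integrable_B) auto
    show "grid_stop h T (Suc n) \<in> borel_measurable M"
      by (rule measurable_F_M[OF measurable_grid_stop[OF assms]])
  qed auto
qed

text \<open>Martingale increments are orthogonal: the cross term has mean 0 and every step adds at
  most \<open>h\<close>. The bound depends only on the total time \<open>n * h\<close>, hence is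
  uniform in the mesh.\<close>

lemma grid_stop_L2:
  assumes T: "stopping_time F T" and h: "0 < h"
  shows "integrable M (\<lambda>\<omega>. (grid_stop h T n \<omega> - B 0 \<omega>)\<^sup>2)
    \<and> expectation (\<lambda>\<omega>. (grid_stop h T n \<omega> - B 0 \<omega>)\<^sup>2) \<le> real n * h"
proof (induction n)
  case 0
  then show ?case by simp
next
  case (Suc n)
  let ?s = "real n * h" and ?t = "real (Suc n) * h"
  have st: "0 \<le> ?s" "?s < ?t" using h by auto
  define I where "I = (\<lambda>\<omega>. of_bool (ennreal ?s < T \<omega>) :: real)"
  have pr[measurable]: "Measurable.pred (F (ennreal ?s)) (\<lambda>\<omega>. ennreal ?s < T \<omega>)"
    by (rule stopping_timeD2[OF T])
  have mI: "I \<in> borel_measurable (F (ennreal ?s))" unfolding I_def by measurable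
  have iI: "integrable M I"
    by (rule integrable_const_bound[of _ 1]) (auto simp: I_def intro: measurable_F_M[OF mI[unfolded I_def]])
  define Y where "Y = (\<lambda>\<omega>. 2 * (grid_stop h T n \<omega> - B 0 \<omega>) * I \<omega>)"
  have [measurable]: "grid_stop h T n \<in> borel_measurable (F (ennreal ?s))"
     "B 0 \<in> borel_measurable (F (ennreal ?s))" "I \<in> borel_measurable (F (ennreal ?s))"
    using measurable_grid_stop[OF T h] measurable_F[OF adapted[of 0]] mI by auto
  have mY: "Y \<in> borel_measurable (F (ennreal ?s))" unfolding Y_def by measurable
  have iY: "integrable M Y"
    by (rule Bochner_Integration.integrable_bound[of _ "\<lambda>\<omega>. 2 * (grid_stop h T n \<omega> - B 0 \<omega>)"])
      (use integrable_grid_stop[OF T h] integrable_B0 measurable_F_M[OF mY] in \<open>auto simp: Y_def I_def\<close>)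
  have eq: "(\<lambda>\<omega>. (grid_stop h T (Suc n) \<omega> - B 0 \<omega>)\<^sup>2) = (\<lambda>\<omega>. (grid_stop h T n \<omega> - B 0 \<omega>)\<^sup>2
      + Y \<omega> * (B ?t \<omega> - B ?s \<omega>) ^ 1 + I \<omega> * (B ?t \<omega> - B ?s \<omega>)\<^sup>2)"
  proof
    fix \<omega>
    have "ennreal ?s < T \<omega> \<Longrightarrow> grid_stop h T n \<omega> = B ?s \<omega>"
      by (rule grid_stop_before) (use h in auto)
    then show "(grid_stop h T (Suc n) \<omega> - B 0 \<omega>)\<^sup>2 = (grid_stop h T n \<omega> - B 0 \<omega>)\<^sup>2
      + Y \<omega> * (B ?t \<omega> - B ?s \<omega>) ^ 1 + I \<omega> * (B ?t \<omega> - B ?s \<omega>)\<^sup>2"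
      by (auto simp: Y_def I_def power2_eq_square algebra_simps)
  qed
  note i1 = increment_independent[OF st mY iY, of 1] and i2 = increment_independent[OF st mI iI, of 2]
  have "expectation I \<le> 1"
    using integral_mono[OF iI, of "\<lambda>_. 1"] by (auto simp: I_def prob_space)
  with h have "expectation I * (?t - ?s) \<le> h" by (simp add: algebra_simps)
  moreover have "expectation (\<lambda>\<omega>. (grid_stop h T (Suc n) \<omega> - B 0 \<omega>)\<^sup>2)
      = expectation (\<lambda>\<omega>. (grid_stop h T n \<omega> - B 0 \<omega>)\<^sup>2) + expectation I * (?t - ?s)"
    unfolding eq using Suc i1 i2 increment_moments(2,3)[OF st] by (simp del: of_nat_Suc)
  moreover have "integrable M (\<lambda>\<omega>. (grid_stop h T (Suc n) \<omega> - B 0 \<omega>)\<^sup>2)"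
    unfolding eq using Suc i1 i2 by (intro Bochner_Integration.integrable_add) auto
  ultimately show ?case using Suc by (simp add: algebra_simps)
qed

text \<open>With \<open>c = 0\<close> this is the submartingale inequality for \<open>\<phi>\<close>. The term \<open>y\<^sup>2 - y ^ 4\<close> has mean
  \<open>h - 3 * h\<^sup>2 \<ge> h / 2\<close> over a step of length \<open>h \<le> 1 / 6\<close>, and it is negative for large \<open>y\<close>, so that even
  functions of linear growth satisfy the hypothesis with \<open>c > 0\<close>.\<close>

lemma grid_stop_mono:
  assumes S: "stopping_time F S" and T: "stopping_time F T" and le: "\<And>\<omega>. S \<omega> \<le> T \<omega>"
    and h: "0 < h" "h \<le> 1 / 6"
    and \<phi>: "\<And>x y. \<phi> x + d x * y + c x * (y\<^sup>2 - y ^ 4) \<le> \<phi> (x + y)"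
    and [measurable]: "\<phi> \<in> borel_measurable borel" "d \<in> borel_measurable borel" "c \<in> borel_measurable borel"
    and lip: "\<And>x. \<bar>\<phi> x\<bar> \<le> L + \<bar>x\<bar>" and d: "\<And>x. \<bar>d x\<bar> \<le> 1" and c: "\<And>x. 0 \<le> c x" "\<And>x. c x \<le> 1"
  shows "h / 2 * (\<Sum>j<n. expectation (\<lambda>\<omega>. of_bool (S \<omega> \<le> ennreal (real j * h) \<and> ennreal (real j * h) < T \<omega>)
      * c (B (real j * h) \<omega>)))
    \<le> expectation (\<lambda>\<omega>. \<phi> (grid_stop h T n \<omega>)) - expectation (\<lambda>\<omega>. \<phi> (grid_stop h S n \<omega>))"
proof (induction n)
  case 0
  then show ?case by simp
next
  case (Suc n)
  have int\<phi>: "integrable M (\<lambda>\<omega>. \<phi> (Y \<omega>))" if "integrable M Y" for Y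
    by (rule Bochner_Integration.integrable_bound[of _ "\<lambda>\<omega>. \<bar>L\<bar> + \<bar>Y \<omega>\<bar>"])
      (use that lip in \<open>auto intro!: measurable_compose[of Y M borel \<phi>] order_trans[OF lip]\<close>)
  let ?s = "real n * h" and ?t = "real (Suc n) * h"
  have st: "0 \<le> ?s" "?s < ?t" using h by auto
  \<comment> \<open>\<open>I\<close> marks the event that \<open>S\<close> has stopped while
    \<open>T\<close> still runs; only there do the increments of the two grid processes differ over
    this step.\<close>
  define I where "I = (\<lambda>\<omega>. of_bool (S \<omega> \<le> ennreal ?s \<and> ennreal ?s < T \<omega>) :: real)"
  have [measurable]: "Measurable.pred (F (ennreal ?s)) (\<lambda>\<omega>. ennreal ?s < T \<omega>)"
    "Measurable.pred (F (ennreal ?s)) (\<lambda>\<omega>. S \<omega> \<le> ennreal ?s)"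
    by (rule stopping_timeD2[OF T] stopping_timeD[OF S])+
  have [measurable]: "I \<in> borel_measurable (F (ennreal ?s))" "B ?s \<in> borel_measurable (F (ennreal ?s))"
    using adapted[OF st(1)] unfolding I_def by measurable
  have I01: "I \<omega> = 0 \<or> I \<omega> = 1" for \<omega> by (auto simp: I_def)
  define Yd where "Yd = (\<lambda>\<omega>. I \<omega> * d (B ?s \<omega>))"
  define Yc where "Yc = (\<lambda>\<omega>. I \<omega> * c (B ?s \<omega>))"
  have mY: "Yd \<in> borel_measurable (F (ennreal ?s))" "Yc \<in> borel_measurable (F (ennreal ?s))"
    unfolding Yd_def Yc_def by measurable
  have Yd1: "\<bar>Yd \<omega>\<bar> \<le> 1" for \<omega> using I01[of \<omega>] d by (auto simp: Yd_def)
  have Yc1: "\<bar>Yc \<omega>\<bar> \<le> 1" "0 \<le> Yc \<omega>" for \<omega> using I01[of \<omega>] c by (auto simp: Yc_def abs_of_nonneg)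
  have iY: "integrable M Yd" "integrable M Yc"
    by (rule integrable_const_bound[of _ 1]; use Yd1 Yc1 measurable_F_M[OF mY(1)] measurable_F_M[OF mY(2)] in auto)+
  let ?D = "\<lambda>\<omega>. B ?t \<omega> - B ?s \<omega>"
  let ?V = "\<lambda>T n \<omega>. \<phi> (grid_stop h T n \<omega>)"
  have iV: "integrable M (?V S n)" "integrable M (?V T n)" "integrable M (?V S (Suc n))" "integrable M (?V T (Suc n))"
    by (intro int\<phi> integrable_grid_stop S T h)+
  note i1 = increment_independent[OF st mY(1) iY(1), of 1]
    and i2 = increment_independent[OF st mY(2) iY(2), of 2]
    and i4 = increment_independent[OF st mY(2) iY(2), of 4]
  have "expectation Yc \<ge> 0" using Yc1 by (intro integral_nonneg_AE) auto
  have th: "?t - ?s = h" by (simp add: algebra_simps)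
  have "3 * h * h \<le> 1/2 * h" using h by (intro mult_right_mono) auto
  then have "h / 2 \<le> h - 3 * h\<^sup>2" by (simp add: power2_eq_square)
  then have "h / 2 * expectation Yc \<le> (h - 3 * h\<^sup>2) * expectation Yc"
    by (rule mult_right_mono) fact
  also have "\<dots> = expectation (\<lambda>\<omega>. Yd \<omega> * ?D \<omega> ^ 1 + (Yc \<omega> * (?D \<omega>)\<^sup>2 - Yc \<omega> * ?D \<omega> ^ 4))"
  proof -
    have "expectation (\<lambda>\<omega>. Yd \<omega> * ?D \<omega> ^ 1 + (Yc \<omega> * (?D \<omega>)\<^sup>2 - Yc \<omega> * ?D \<omega> ^ 4))
      = expectation (\<lambda>\<omega>. Yd \<omega> * ?D \<omega> ^ 1) + (expectation (\<lambda>\<omega>. Yc \<omega> * (?D \<omega>)\<^sup>2)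
        - expectation (\<lambda>\<omega>. Yc \<omega> * ?D \<omega> ^ 4))"
      by (simp only: Bochner_Integration.integral_add Bochner_Integration.integral_diff
          Bochner_Integration.integrable_diff i1(1) i2(1) i4(1))
    also have "expectation (\<lambda>\<omega>. Yd \<omega> * ?D \<omega> ^ 1) = 0"
      using i1(2) increment_moments(2)[OF st] by simp
    also have "expectation (\<lambda>\<omega>. Yc \<omega> * (?D \<omega>)\<^sup>2) - expectation (\<lambda>\<omega>. Yc \<omega> * ?D \<omega> ^ 4)
        = expectation Yc * h - expectation Yc * (3 * h\<^sup>2)"
      unfolding i2(2) i4(2) increment_moments(3,4)[OF st] th ..
    finally show ?thesis by (simp add: algebra_simps)
  qed
  also have "\<dots> \<le> expectation (\<lambda>\<omega>. (?V T (Suc n) \<omega> - ?V T n \<omega>) - (?V S (Suc n) \<omega> - ?V S n \<omega>))"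
  proof (rule integral_mono)
    fix \<omega>
    \<comment> \<open>If both processes run, they sit at the same point and their increments cancel;
      if only \<open>T\<close> runs, the hypothesis on \<phi> applies at \<open>B ?s\<close>. That
      \<open>S\<close> runs alone is excluded by \<open>S \<le> T\<close>.\<close>
    have bT: "ennreal ?s < T \<omega> \<Longrightarrow> grid_stop h T n \<omega> = B ?s \<omega>"
      and bS: "ennreal ?s < S \<omega> \<Longrightarrow> grid_stop h S n \<omega> = B ?s \<omega>"
      by (rule grid_stop_before; use h in auto)+
    show "Yd \<omega> * ?D \<omega> ^ 1 + (Yc \<omega> * (?D \<omega>)\<^sup>2 - Yc \<omega> * ?D \<omega> ^ 4)
        \<le> (?V T (Suc n) \<omega> - ?V T n \<omega>) - (?V S (Suc n) \<omega> - ?V S n \<omega>)"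
      using bT bS \<phi>[of "B ?s \<omega>" "?D \<omega>"] less_le_trans[OF _ le[of \<omega>], of "ennreal ?s"]
      by (auto simp: Yd_def Yc_def I_def algebra_simps)
  qed (intro Bochner_Integration.integrable_diff Bochner_Integration.integrable_add iV i1 i2 i4)+
  also have "\<dots> = (expectation (?V T (Suc n)) - expectation (?V S (Suc n)))
      - (expectation (?V T n) - expectation (?V S n))"
    using iV by (simp del: grid_stop.simps)
  finally show ?case
    using Suc unfolding Yc_def I_def by (simp add: algebra_simps)
qed

end

section \<open>Convex functions of the stopped process\<close>

text \<open>The coefficient of \<open>y\<^sup>2 - y ^ 4\<close> is a quarter of the second
  derivative, half of what Taylor's formula gives for small \<open>y\<close>. With \<open>s\<close>,
  \<open>t\<close> the two roots and \<open>u = 1 + x * (x + y)\<close>, the gap above the tangent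
  line is \<open>(s * t - u) / s\<close>. Lagrange's identity for the vectors \<open>(1, x)\<close>
  and \<open>(1, x + y)\<close> turns \<open>s * t - u\<close> into
  \<open>y\<^sup>2 / (s * t + u)\<close>.\<close>

lemma sqrt_one_plus_square_support:
  fixes x y :: real
  shows "sqrt (1 + x\<^sup>2) + x / sqrt (1 + x\<^sup>2) * y + 1 / (4 * sqrt (1 + x\<^sup>2) ^ 3) * (y\<^sup>2 - y ^ 4)
    \<le> sqrt (1 + (x + y)\<^sup>2)"
proof -
  define s t where "s = sqrt (1 + x\<^sup>2)" and "t = sqrt (1 + (x + y)\<^sup>2)"
  have s1: "1 \<le> s" and t1: "1 \<le> t" by (auto simp: s_def t_def)
  have s2: "s\<^sup>2 = 1 + x\<^sup>2" and t2: "t\<^sup>2 = 1 + (x + y)\<^sup>2" by (auto simp: s_def t_def)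
  have y4: "y ^ 4 = y\<^sup>2 * y\<^sup>2" by (simp add: power2_eq_square power4_eq_xxxx)
  define u where "u = 1 + x * (x + y)"
  have "(s * t - u) * (s * t + u) = s\<^sup>2 * t\<^sup>2 - u\<^sup>2" by (simp add: power2_eq_square algebra_simps)
  also have "\<dots> = (1 + x\<^sup>2) * (1 + (x + y)\<^sup>2) - (1 + x * (x + y))\<^sup>2" by (simp only: s2 t2 u_def)
  also have "\<dots> = y\<^sup>2" by (simp add: power2_eq_square algebra_simps)
  finally have lag: "(s * t - u) * (s * t + u) = y\<^sup>2" .
  have "u\<^sup>2 \<le> (s * t)\<^sup>2" using lag by (simp add: power2_eq_square algebra_simps)
  then have u_le: "u \<le> s * t"
    by (rule power2_le_imp_le) (use s1 t1 in auto)
  have ts: "t \<le> s + \<bar>y\<bar>"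
  proof (rule power2_le_imp_le)
    have "\<bar>x\<bar> \<le> s" unfolding s_def by (rule real_le_rsqrt) simp
    then have "\<bar>x\<bar> * \<bar>y\<bar> \<le> s * \<bar>y\<bar>" by (rule mult_right_mono) simp
    moreover have "x * y \<le> \<bar>x\<bar> * \<bar>y\<bar>" by (metis abs_ge_self abs_mult)
    ultimately have "x * y \<le> s * \<bar>y\<bar>" by linarith
    then show "t\<^sup>2 \<le> (s + \<bar>y\<bar>)\<^sup>2" using s2 t2 by (simp add: power2_eq_square algebra_simps)
  qed (use s1 in auto)
  \<comment> \<open>For \<open>\<bar>y\<bar> \<le> 1\<close> the bound \<open>t \<le> 2 * s\<close>
    gives \<open>s * t + u \<le> 4 * s\<^sup>2\<close>; for larger \<open>y\<close> the left side is
    not positive and the right side is not negative.\<close>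
  have main: "y\<^sup>2 * (1 - y\<^sup>2) \<le> 4 * s\<^sup>2 * (s * t - u)"
  proof (cases "\<bar>y\<bar> \<le> 1")
    case True
    have "t \<le> 2 * s" using ts True s1 by linarith
    then have "s * t + u \<le> 4 * s\<^sup>2"
      unfolding power2_eq_square using u_le mult_left_mono[OF \<open>t \<le> 2 * s\<close>, of s] s1 by linarith
    then have "y\<^sup>2 \<le> 4 * s\<^sup>2 * (s * t - u)"
      unfolding lag[symmetric] mult.commute[of "4 * s\<^sup>2"] using u_le by (intro mult_left_mono) auto
    moreover have "y\<^sup>2 * (1 - y\<^sup>2) \<le> y\<^sup>2" by (simp add: algebra_simps)
    ultimately show ?thesis by linarith
  next
    case False
    then have "1 \<le> y\<^sup>2" by (metis abs_square_le_1 linear power2_abs)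
    then have "y\<^sup>2 * (1 - y\<^sup>2) \<le> 0" by (simp add: mult_nonneg_nonpos)
    moreover have "0 \<le> 4 * s\<^sup>2 * (s * t - u)" using u_le by simp
    ultimately show ?thesis by linarith
  qed
  have eq: "t - s - x / s * y = (s * t - u) / s"
    using s1 s2 by (simp add: u_def field_simps power2_eq_square)
  have "1 / (4 * s ^ 3) * (y\<^sup>2 - y ^ 4) = y\<^sup>2 * (1 - y\<^sup>2) / (4 * s\<^sup>2 * s)"
    by (simp add: y4 algebra_simps power2_eq_square power3_eq_cube)
  also have "\<dots> \<le> 4 * s\<^sup>2 * (s * t - u) / (4 * s\<^sup>2 * s)"
    by (rule divide_right_mono[OF main]) (use s1 in auto)
  also have "\<dots> = t - s - x / s * y"
    unfolding eq using s1 by simp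
  finally show ?thesis unfolding s_def t_def by linarith
qed

lemma sqrt_one_plus_square_lipschitz: "\<bar>sqrt (1 + x\<^sup>2) - sqrt (1 + y\<^sup>2)\<bar> \<le> \<bar>x - y\<bar>" for x y :: real
proof -
  have "sqrt (1 + a\<^sup>2) \<le> sqrt (1 + b\<^sup>2) + \<bar>a - b\<bar>" for a b :: real
  proof (rule power2_le_imp_le)
    define s where "s = sqrt (1 + b\<^sup>2)"
    have s2: "s\<^sup>2 = 1 + b\<^sup>2" by (simp add: s_def)
    have "\<bar>b\<bar> \<le> s" unfolding s_def by (rule real_le_rsqrt) simp
    then have "\<bar>b\<bar> * \<bar>a - b\<bar> \<le> s * \<bar>a - b\<bar>" by (rule mult_right_mono) auto
    moreover have "b * (a - b) \<le> \<bar>b\<bar> * \<bar>a - b\<bar>" by (metis abs_ge_self abs_mult)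
    ultimately have "2 * b * (a - b) \<le> 2 * s * \<bar>a - b\<bar>" by simp
    then show "(sqrt (1 + a\<^sup>2))\<^sup>2 \<le> (sqrt (1 + b\<^sup>2) + \<bar>a - b\<bar>)\<^sup>2"
      using s2 unfolding s_def[symmetric] by (simp add: power2_eq_square algebra_simps)
  qed auto
  from this[of x y] this[of y x] show ?thesis by (simp add: abs_le_iff abs_minus_commute)
qed

section \<open>Passage from the grid to continuous time\<close>

context brownian_motion
begin

text \<open>The cutoff at \<open>N\<close> keeps the time finite, so \<open>enn2real\<close> loses
  nothing even where \<open>T = \<infinity>\<close>, and it provides the L2 bound that justifies
  passing to the limit.\<close>

definition stop_at :: "nat \<Rightarrow> ('a \<Rightarrow> ennreal) \<Rightarrow> 'a \<Rightarrow> real" where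
  "stop_at N T \<omega> = B (enn2real (min (T \<omega>) (ennreal (real N)))) \<omega>"

lemma stop_at_zero [simp]: "stop_at N (\<lambda>\<omega>. 0) = B 0"
  by (simp add: stop_at_def fun_eq_iff)

lemma tendsto_B:
  assumes "\<omega> \<in> space M" "s \<longlonglongrightarrow> t" "\<And>k. 0 \<le> s k" "0 \<le> t"
  shows "(\<lambda>k. B (s k) \<omega>) \<longlonglongrightarrow> B t \<omega>"
  using continuous_on_tendsto_compose[OF continuous_paths[OF assms(1)] assms(2)] assms(3,4) by auto

lemma tendsto_grid_stop:
  assumes "\<omega> \<in> space M"
  shows "(\<lambda>k. grid_stop ((1/2)^k) T (N * 2^k) \<omega>) \<longlonglongrightarrow> stop_at N T \<omega>"
proof -
  define \<tau> where "\<tau> = enn2real (min (T \<omega>) (ennreal (real N)))"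
  have "real (N * 2^k) * (1/2)^k = real N" for k by (simp add: power_one_over)
  then have "\<forall>k. \<exists>s. grid_stop ((1/2)^k) T (N * 2^k) \<omega> = B s \<omega> \<and> \<tau> \<le> s \<and> s \<le> \<tau> + (1/2)^k"
    using grid_stop_time[of "(1/2)^k" T "N * 2^k" \<omega> for k] unfolding \<tau>_def by (metis zero_less_power half_gt_zero zero_less_one)
  then obtain s where s: "\<And>k. grid_stop ((1/2)^k) T (N * 2^k) \<omega> = B (s k) \<omega>"
      "\<And>k. \<tau> \<le> s k" "\<And>k. s k \<le> \<tau> + (1/2)^k" by metis
  have "(\<lambda>k. \<tau> + (1/2)^k) \<longlonglongrightarrow> \<tau> + 0" by (intro tendsto_intros) auto
  then have "s \<longlonglongrightarrow> \<tau>" using s by (intro tendsto_sandwich[of "\<lambda>_. \<tau>" s _ "\<lambda>k. \<tau> + (1/2)^k"]) auto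
  moreover have "0 \<le> \<tau>" by (simp add: \<tau>_def)
  ultimately show ?thesis
    unfolding s stop_at_def \<tau>_def[symmetric] using assms s by (intro tendsto_B) (auto intro: order_trans)
qed

lemma measurable_stop_at:
  assumes "stopping_time F T"
  shows "stop_at N T \<in> borel_measurable M"
  by (rule borel_measurable_LIMSEQ_real[OF tendsto_grid_stop])
    (use measurable_F_M[OF measurable_grid_stop[OF assms]] in auto)

end

context integrable_brownian_motion
begin

text \<open>Only the displacement from \<open>B 0\<close> is bounded in L2, as \<open>B 0\<close> is
  merely assumed integrable. So \<phi> of the starting value is subtracted first: by the Lipschitz
  bound the difference has second moment at most \<open>N\<close> for every
  \<open>k\<close>.\<close>

lemma expectation_grid_stop_tendsto:
  fixes \<phi> :: "real \<Rightarrow> real"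
  assumes T: "stopping_time F T" and lip: "\<And>x y. \<bar>\<phi> x - \<phi> y\<bar> \<le> \<bar>x - y\<bar>"
  shows "integrable M (\<lambda>\<omega>. \<phi> (stop_at N T \<omega>))"
    and "(\<lambda>k. expectation (\<lambda>\<omega>. \<phi> (grid_stop ((1/2)^k) T (N * 2^k) \<omega>))) \<longlonglongrightarrow> expectation (\<lambda>\<omega>. \<phi> (stop_at N T \<omega>))"
proof -
  have cont: "continuous_on UNIV \<phi>"
    using lip by (intro continuous_on_iff[THEN iffD2]) (auto simp: dist_real_def intro: le_less_trans)
  have [measurable]: "\<phi> \<in> borel_measurable borel" by (rule borel_measurable_continuous_onI[OF cont])
  let ?G = "\<lambda>k. grid_stop ((1/2)^k) T (N * 2^k)"
  have [measurable]: "?G k \<in> borel_measurable M" "B 0 \<in> borel_measurable M" for k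
    using measurable_F_M[OF measurable_grid_stop[OF T]] measurable_B by auto
  have abs_\<phi>: "\<bar>\<phi> x\<bar> \<le> \<bar>\<phi> 0\<bar> + \<bar>x\<bar>" for x using lip[of x 0] by simp
  have int\<phi>: "integrable M (\<lambda>\<omega>. \<phi> (Y \<omega>))" if "integrable M Y" for Y
    by (rule Bochner_Integration.integrable_bound[of _ "\<lambda>\<omega>. \<bar>\<phi> 0\<bar> + \<bar>Y \<omega>\<bar>"])
      (use that abs_\<phi> in \<open>auto intro!: measurable_compose[of Y M borel \<phi>]\<close>)
  let ?Y = "\<lambda>k \<omega>. \<phi> (?G k \<omega>) - \<phi> (B 0 \<omega>)"
  have sq: "(?Y k \<omega>)\<^sup>2 \<le> (?G k \<omega> - B 0 \<omega>)\<^sup>2" for k \<omega>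
    using lip by (simp add: abs_le_square_iff[symmetric])
  have L2: "integrable M (\<lambda>\<omega>. (?G k \<omega> - B 0 \<omega>)\<^sup>2)" "expectation (\<lambda>\<omega>. (?G k \<omega> - B 0 \<omega>)\<^sup>2) \<le> real N" for k
    using grid_stop_L2[OF T, of "(1/2)^k" "N * 2^k"] by (auto simp: power_one_over)
  have i2: "integrable M (\<lambda>\<omega>. (?Y k \<omega>)\<^sup>2)" for k
    by (rule Bochner_Integration.integrable_bound[OF L2(1)[of k]]) (use sq in auto)
  have lim: "(\<lambda>k. ?Y k \<omega>) \<longlonglongrightarrow> \<phi> (stop_at N T \<omega>) - \<phi> (B 0 \<omega>)" if "\<omega> \<in> space M" for \<omega>
    by (intro tendsto_intros continuous_on_tendsto_compose[OF cont] tendsto_grid_stop that) auto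
  have bd: "expectation (\<lambda>\<omega>. (?Y k \<omega>)\<^sup>2) \<le> real N" for k
    by (rule order_trans[OF integral_mono[OF i2 L2(1) sq] L2(2)])
  have "?Y k \<in> borel_measurable M" for k by measurable
  note * = integral_tendsto_of_L2_bounded[of ?Y, OF this i2 lim bd]
  note i0 = int\<phi>[OF integrable_B0]
  from Bochner_Integration.integrable_add[OF *(1) i0]
  show i: "integrable M (\<lambda>\<omega>. \<phi> (stop_at N T \<omega>))" by simp
  have "integrable M (\<lambda>\<omega>. \<phi> (?G k \<omega>))" for k
    by (rule int\<phi>[OF integrable_grid_stop[OF T]]) auto
  with *(2) i i0 have "(\<lambda>k. expectation (\<lambda>\<omega>. \<phi> (?G k \<omega>)) - expectation (\<lambda>\<omega>. \<phi> (B 0 \<omega>)))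
      \<longlonglongrightarrow> expectation (\<lambda>\<omega>. \<phi> (stop_at N T \<omega>)) - expectation (\<lambda>\<omega>. \<phi> (B 0 \<omega>))" by simp
  from tendsto_add[OF this tendsto_const[of "expectation (\<lambda>\<omega>. \<phi> (B 0 \<omega>))"]]
  show "(\<lambda>k. expectation (\<lambda>\<omega>. \<phi> (?G k \<omega>))) \<longlonglongrightarrow> expectation (\<lambda>\<omega>. \<phi> (stop_at N T \<omega>))" by simp
qed

lemma integrable_stop_at:
  assumes "stopping_time F T"
  shows "integrable M (stop_at N T)"
  using expectation_grid_stop_tendsto(1)[OF assms, of "\<lambda>x. x"] by simp

text \<open>The limit of \<open>grid_stop_mono\<close> with \<open>c = 0\<close>; \<open>d\<close>
  is a measurable choice of subgradient of \<phi>.\<close>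

lemma stop_at_convex_mono:
  fixes \<phi> d :: "real \<Rightarrow> real"
  assumes S: "stopping_time F S" and T: "stopping_time F T" and le: "\<And>\<omega>. S \<omega> \<le> T \<omega>"
    and lip: "\<And>x y. \<bar>\<phi> x - \<phi> y\<bar> \<le> \<bar>x - y\<bar>" and conv: "\<And>x y. \<phi> x + d x * y \<le> \<phi> (x + y)"
    and d: "d \<in> borel_measurable borel" "\<And>x. \<bar>d x\<bar> \<le> 1"
  shows "expectation (\<lambda>\<omega>. \<phi> (stop_at N S \<omega>)) \<le> expectation (\<lambda>\<omega>. \<phi> (stop_at N T \<omega>))"
proof (rule LIMSEQ_le[OF expectation_grid_stop_tendsto(2)[OF S lip] expectation_grid_stop_tendsto(2)[OF T lip]])
  have cont: "continuous_on UNIV \<phi>"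
    using lip by (intro continuous_on_iff[THEN iffD2]) (auto simp: dist_real_def intro: le_less_trans)
  have m: "\<phi> \<in> borel_measurable borel" by (rule borel_measurable_continuous_onI[OF cont])
  have "expectation (\<lambda>\<omega>. \<phi> (grid_stop ((1/2)^k) S (N * 2^k) \<omega>))
      \<le> expectation (\<lambda>\<omega>. \<phi> (grid_stop ((1/2)^k) T (N * 2^k) \<omega>))" if k: "3 \<le> k" for k
  proof -
    \<comment> \<open>\<open>k \<ge> 3\<close> makes the mesh at most 1/8, below the 1/6
      required.\<close>
    have "(1/2::real) ^ k \<le> (1/2) ^ 3" using k by (intro power_decreasing) auto
    then have h: "(1/2::real) ^ k \<le> 1 / 6" by (simp add: power3_eq_cube)
    have "\<bar>\<phi> x\<bar> \<le> \<bar>\<phi> 0\<bar> + \<bar>x\<bar>" for x using lip[of x 0] by simp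
    from grid_stop_mono[OF S T le _ h _ m d(1) _ this d(2), of "\<lambda>_. 0" "N * 2^k"] conv
    show ?thesis by simp
  qed
  then show "\<exists>n0. \<forall>k\<ge>n0. expectation (\<lambda>\<omega>. \<phi> (grid_stop ((1/2)^k) S (N * 2^k) \<omega>))
      \<le> expectation (\<lambda>\<omega>. \<phi> (grid_stop ((1/2)^k) T (N * 2^k) \<omega>))" by blast
qed

text \<open>The submartingale inequality for \<open>x\<close> and for \<open>-x\<close>, compared
  with the stopping time 0.\<close>

lemma expectation_stop_at:
  assumes T: "stopping_time F T"
  shows "expectation (stop_at N T) = expectation (B 0)"
proof (rule antisym)
  show "expectation (stop_at N T) \<le> expectation (B 0)"
    using stop_at_convex_mono[OF stopping_time_const[of F 0] T, of "\<lambda>x. -x" "\<lambda>_. -1" N]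
      integrable_stop_at[OF T] integrable_B0 by simp
  show "expectation (B 0) \<le> expectation (stop_at N T)"
    using stop_at_convex_mono[OF stopping_time_const[of F 0] T, of "\<lambda>x. x" "\<lambda>_. 1" N] by simp
qed

lemma expectation_abs_stop_at_mono:
  assumes S: "stopping_time F S" and T: "stopping_time F T" and le: "\<And>\<omega>. S \<omega> \<le> T \<omega>"
  shows "expectation (\<lambda>\<omega>. \<bar>stop_at N S \<omega> - z\<bar>) \<le> expectation (\<lambda>\<omega>. \<bar>stop_at N T \<omega> - z\<bar>)"
proof (rule stop_at_convex_mono[OF S T le, where d = "\<lambda>x. if z \<le> x then 1 else - 1"])
  show "\<bar>\<bar>x - z\<bar> - \<bar>y - z\<bar>\<bar> \<le> \<bar>x - y\<bar>" for x y :: real by arith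
  show "\<bar>x - z\<bar> + (if z \<le> x then 1 else - 1) * y \<le> \<bar>x + y - z\<bar>" for x y :: real by (simp add: abs_if)
qed auto

text \<open>A crude consequence of \<open>\<bar>x\<bar> \<le> 1 + x\<^sup>2\<close>; it makes
  Markov's inequality uniform over a bounded range of times.\<close>

lemma expectation_abs_B_le:
  assumes "0 \<le> s" "s \<le> t"
  shows "expectation (\<lambda>\<omega>. \<bar>B s \<omega>\<bar>) \<le> expectation (\<lambda>\<omega>. \<bar>B 0 \<omega>\<bar>) + 1 + t"
proof (cases "s = 0")
  case False
  then have s: "0 < s" using assms by simp
  note m = increment_moments[OF order_refl s]
  have "expectation (\<lambda>\<omega>. \<bar>B s \<omega>\<bar>) \<le> expectation (\<lambda>\<omega>. \<bar>B 0 \<omega>\<bar> + (1 + (B s \<omega> - B 0 \<omega>)\<^sup>2))"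
  proof (rule integral_mono)
    fix \<omega>
    have "\<bar>x\<bar> \<le> 1 + x\<^sup>2" for x :: real
      using zero_le_power2[of "\<bar>x\<bar> - 1"] by (simp add: power2_eq_square algebra_simps)
    from this[of "B s \<omega> - B 0 \<omega>"]
    show "\<bar>B s \<omega>\<bar> \<le> \<bar>B 0 \<omega>\<bar> + (1 + (B s \<omega> - B 0 \<omega>)\<^sup>2)" by linarith
  qed (use integrable_B[of s] integrable_B0 m(1)[of 2] assms in auto)
  also have "\<dots> = expectation (\<lambda>\<omega>. \<bar>B 0 \<omega>\<bar>) + (1 + s)"
    using integrable_B0 m(1)[of 2] m(3) by (simp add: prob_space)
  finally show ?thesis using assms by simp
qed (use assms in auto)

text \<open>On the given event \<open>S\<close> has stopped and \<open>T\<close> still runs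
  throughout a dyadic cell. A grid of mesh \<open>(1/2)^k\<close> with \<open>k \<ge> m\<close> has
  \<open>2^(k-m)\<close> points there, and each adds at least a fixed amount to the sum in
  \<open>grid_stop_mono\<close>. The factor \<open>h / 2\<close> in front of that sum balances their
  number, so the gain survives the limit.\<close>

lemma stop_at_strict_mono:
  assumes S: "stopping_time F S" and T: "stopping_time F T" and le: "\<And>\<omega>. S \<omega> \<le> T \<omega>"
    and pos: "0 < prob {\<omega> \<in> space M. S \<omega> \<le> ennreal (real i * (1/2)^m) \<and> ennreal (real (Suc i) * (1/2)^m) \<le> T \<omega>}"
      (is "0 < prob ?A")
  shows "\<exists>\<delta>>0. \<forall>N\<ge>Suc i. \<delta> \<le> expectation (\<lambda>\<omega>. sqrt (1 + (stop_at N T \<omega>)\<^sup>2))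
    - expectation (\<lambda>\<omega>. sqrt (1 + (stop_at N S \<omega>)\<^sup>2))"
proof -
  \<comment> \<open>The convexity constant from \<open>sqrt_one_plus_square_support\<close>. It is
    positive but decays at infinity, hence the need to confine \<open>B\<close> to a bounded
    range.\<close>
  define c where "c = (\<lambda>x::real. 1 / (4 * sqrt (1 + x\<^sup>2) ^ 3))"
  have c0: "0 < c x" for x
    unfolding c_def by (intro divide_pos_pos mult_pos_pos zero_less_power) (auto simp: add_pos_nonneg)
  have c_mono: "c K \<le> c x" if "\<bar>x\<bar> \<le> K" for x K
  proof -
    have "x\<^sup>2 \<le> K\<^sup>2" using that by (simp add: abs_le_square_iff[symmetric])
    then have "sqrt (1 + x\<^sup>2) ^ 3 \<le> sqrt (1 + K\<^sup>2) ^ 3" by (intro power_mono) auto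
    moreover have "0 < sqrt (1 + x\<^sup>2) ^ 3" by (auto simp: add_pos_nonneg)
    ultimately show ?thesis unfolding c_def by (intro divide_left_mono) (auto simp: zero_less_mult_iff)
  qed
  have c1: "c x \<le> 1" for x
  proof -
    have "1 \<le> sqrt (1 + x\<^sup>2) ^ 3" by (rule one_le_power) simp
    then show ?thesis unfolding c_def by (subst divide_le_eq_1) linarith
  qed
  have [measurable]: "c \<in> borel_measurable borel" unfolding c_def by measurable
  have [measurable]: "Measurable.pred M (\<lambda>\<omega>. S \<omega> \<le> t)" "Measurable.pred M (\<lambda>\<omega>. t < T \<omega>)"
      "T \<in> borel_measurable M" "S \<in> borel_measurable M" for t
    by (rule pred_F_M[OF stopping_timeD[OF S]] pred_F_M[OF stopping_timeD2[OF T]]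
      measurable_stopping_time[OF T sets_F_subset space_F] measurable_stopping_time[OF S sets_F_subset space_F])+
  define A where "A = ?A"
  have A[measurable]: "A \<in> sets M" unfolding A_def by measurable
  note pos = pos[folded A_def]
  have iA: "integrable M (indicator A :: 'a \<Rightarrow> real)" "expectation (indicator A) = prob A"
    using A sets.sets_into_space[OF A] by (auto simp: emeasure_finite less_top[symmetric] Int_absorb2)
  define K1 where "K1 = expectation (\<lambda>\<omega>. \<bar>B 0 \<omega>\<bar>) + 1 + real (Suc i)"
  have K1: "0 < K1" unfolding K1_def by (intro add_nonneg_pos add_nonneg_nonneg) auto
  \<comment> \<open>With this \<open>K\<close>, Markov's inequality shows that
    \<open>\<bar>B s\<bar> > K\<close> removes at most half of the probability of
    \<open>A\<close>.\<close>
  define K where "K = 2 * K1 / prob A"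
  have K: "0 < K" using K1 pos by (simp add: K_def)
  define \<gamma> where "\<gamma> = c K * (prob A / 2)"
  have \<gamma>: "0 < \<gamma>" using c0 pos by (simp add: \<gamma>_def)
  have low: "\<gamma> \<le> expectation (\<lambda>\<omega>. indicator A \<omega> * c (B s \<omega>))" if s: "0 \<le> s" "s \<le> real (Suc i)" for s
  proof -
    have [measurable]: "B s \<in> borel_measurable M" by (rule measurable_B[OF s(1)])
    have "expectation (\<lambda>\<omega>. \<bar>B s \<omega>\<bar>) \<le> K1" unfolding K1_def by (rule expectation_abs_B_le[OF s])
    then have "expectation (\<lambda>\<omega>. \<bar>B s \<omega>\<bar>) / K \<le> K1 / K" by (rule divide_right_mono) (use K in auto)
    also have "\<dots> = prob A / 2" using K1 pos by (simp add: K_def)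
    finally have "prob A / 2 \<le> prob A - expectation (\<lambda>\<omega>. \<bar>B s \<omega>\<bar>) / K" by simp
    then have "\<gamma> \<le> c K * (prob A - expectation (\<lambda>\<omega>. \<bar>B s \<omega>\<bar>) / K)"
      unfolding \<gamma>_def using c0[of K] by (intro mult_left_mono) auto
    also have "\<dots> = expectation (\<lambda>\<omega>. c K * (indicator A \<omega> - \<bar>B s \<omega>\<bar> / K))"
      using integrable_B[OF s(1)] iA by simp
    also have "\<dots> \<le> expectation (\<lambda>\<omega>. indicator A \<omega> * c (B s \<omega>))"
    proof (rule integral_mono)
      show "integrable M (\<lambda>\<omega>. c K * (indicator A \<omega> - \<bar>B s \<omega>\<bar> / K))"
        using integrable_B[OF s(1)] iA by simp
      show "integrable M (\<lambda>\<omega>. indicator A \<omega> * c (B s \<omega>))"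
        by (rule integrable_const_bound[of _ 1]) (use c1 c0 in \<open>auto simp: abs_mult less_imp_le abs_of_pos mult_le_one split: split_indicator\<close>)
      fix \<omega>
      \<comment> \<open>Markov's inequality in pointwise form: off the event that
        \<open>\<omega> \<in> A\<close> and \<open>\<bar>B s\<bar> \<le> K\<close> the left side is
        not positive.\<close>
      show "c K * (indicator A \<omega> - \<bar>B s \<omega>\<bar> / K) \<le> indicator A \<omega> * c (B s \<omega>)"
      proof (cases "\<omega> \<in> A \<and> \<bar>B s \<omega>\<bar> \<le> K")
        case True
        have "c K * (1 - \<bar>B s \<omega>\<bar> / K) \<le> c K * 1" using c0[of K] K by (intro mult_left_mono) auto
        also have "\<dots> \<le> c (B s \<omega>)" using c_mono True by simp
        finally show ?thesis using True by simp
      next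
        case False
        then have "(indicator A \<omega> :: real) - \<bar>B s \<omega>\<bar> / K \<le> 0"
          using K by (auto simp: indicator_def field_simps)
        then have "c K * (indicator A \<omega> - \<bar>B s \<omega>\<bar> / K) \<le> 0"
          using c0[of K] by (simp add: mult_nonneg_nonpos)
        also have "0 \<le> indicator A \<omega> * c (B s \<omega>)" using c0[of "B s \<omega>"] by simp
        finally show ?thesis .
      qed
    qed
    finally show ?thesis .
  qed
  define \<delta> where "\<delta> = (1/2)^m / 2 * \<gamma>"
  have "\<delta> \<le> expectation (\<lambda>\<omega>. sqrt (1 + (stop_at N T \<omega>)\<^sup>2)) - expectation (\<lambda>\<omega>. sqrt (1 + (stop_at N S \<omega>)\<^sup>2))"
    if N: "Suc i \<le> N" for N
  proof (rule LIMSEQ_le_const[OF tendsto_diff[OF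
        expectation_grid_stop_tendsto(2)[OF T sqrt_one_plus_square_lipschitz]
        expectation_grid_stop_tendsto(2)[OF S sqrt_one_plus_square_lipschitz]]])
    let ?\<phi> = "\<lambda>x::real. sqrt (1 + x\<^sup>2)"
    have "\<delta> \<le> expectation (\<lambda>\<omega>. ?\<phi> (grid_stop ((1/2)^k) T (N * 2^k) \<omega>))
      - expectation (\<lambda>\<omega>. ?\<phi> (grid_stop ((1/2)^k) S (N * 2^k) \<omega>))" if k: "max 3 m \<le> k" for k
    proof -
      let ?h = "(1/2::real)^k"
      have "?h \<le> (1/2) ^ 3" using k by (intro power_decreasing) auto
      then have h: "0 < ?h" "?h \<le> 1 / 6" by (simp_all add: power3_eq_cube)
      let ?E = "\<lambda>j. expectation (\<lambda>\<omega>. of_bool (S \<omega> \<le> ennreal (real j * ?h) \<and> ennreal (real j * ?h) < T \<omega>)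
        * c (B (real j * ?h) \<omega>))"
      have h0: "0 \<le> real j * ?h" for j by simp
      have [measurable]: "B (real j * ?h) \<in> borel_measurable M" for j by (rule measurable_B[OF h0])
      have E0: "0 \<le> ?E j" for j
        using c0 by (intro Bochner_Integration.integral_nonneg) (auto simp: less_imp_le)
      \<comment> \<open>The indices of the grid points in the dyadic cell. Leaving out the right end
        keeps them strictly before \<open>T\<close>.\<close>
      define J where "J = {i * 2^(k - m)..<Suc i * 2^(k - m)}"
      have hm: "2^(k - m) * ?h = (1/2)^m"
        using k by (simp add: power_diff power_one_over field_simps)
      have Jsub: "J \<subseteq> {..<N * 2^k}"
      proof -
        have "Suc i * 2^(k-m) \<le> N * 2^k" using N by (intro mult_mono power_increasing) auto
        then show ?thesis unfolding J_def by auto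
      qed
      have EJ: "\<gamma> \<le> ?E j" if "j \<in> J" for j
      proof -
        have "real (i * 2^(k-m)) * ?h \<le> real j * ?h"
          using that h unfolding J_def by (intro mult_right_mono) (auto simp del: of_nat_mult)
        then have lo: "real i * (1/2)^m \<le> real j * ?h" using hm by (simp add: mult.assoc)
        have "real j * ?h < real (Suc i * 2^(k-m)) * ?h"
          using that h unfolding J_def by (intro mult_strict_right_mono) (auto simp del: of_nat_mult of_nat_Suc mult_Suc)
        then have hi: "real j * ?h < real (Suc i) * (1/2)^m" using hm by (simp add: mult.assoc del: of_nat_Suc mult_Suc)
        have "(1/2::real)^m \<le> 1" by (rule power_le_one) auto
        then have "real (Suc i) * (1/2)^m \<le> real (Suc i)" by (rule mult_left_le) simp
        with hi have "real j * ?h \<le> real (Suc i)" by linarith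
        from low[OF h0 this] have "\<gamma> \<le> expectation (\<lambda>\<omega>. indicator A \<omega> * c (B (real j * ?h) \<omega>))" .
        also have "\<dots> \<le> ?E j"
        proof (rule integral_mono)
          show "integrable M (\<lambda>\<omega>. indicator A \<omega> * c (B (real j * ?h) \<omega>))"
            by (rule integrable_const_bound[of _ 1]) (use c1 c0 in \<open>auto simp: abs_mult less_imp_le abs_of_pos mult_le_one split: split_indicator\<close>)
          show "integrable M (\<lambda>\<omega>. of_bool (S \<omega> \<le> ennreal (real j * ?h) \<and> ennreal (real j * ?h) < T \<omega>)
              * c (B (real j * ?h) \<omega>))"
            by (rule integrable_const_bound[of _ 1]) (use c1 c0 in \<open>auto simp: less_imp_le\<close>)
          fix \<omega>
          have "S \<omega> \<le> ennreal (real j * ?h)" if "\<omega> \<in> A"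
            using that order_trans[OF _ ennreal_leI[OF lo], of "S \<omega>"] unfolding A_def by blast
          moreover have "ennreal (real j * ?h) < T \<omega>" if "\<omega> \<in> A"
          proof -
            have "ennreal (real j * ?h) < ennreal (real (Suc i) * (1/2)^m)"
              by (rule ennreal_lessI[OF order_le_less_trans[OF h0 hi] hi])
            from less_le_trans[OF this, of "T \<omega>"] that show ?thesis unfolding A_def by blast
          qed
          ultimately show "indicator A \<omega> * c (B (real j * ?h) \<omega>)
              \<le> of_bool (S \<omega> \<le> ennreal (real j * ?h) \<and> ennreal (real j * ?h) < T \<omega>) * c (B (real j * ?h) \<omega>)"
            using c0[of "B (real j * ?h) \<omega>"] by (cases "\<omega> \<in> A") auto
        qed
        finally show ?thesis .
      qed
      have cardJ: "card J = 2^(k-m)" unfolding J_def by simp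
      have "\<delta> = ?h / 2 * (\<Sum>j\<in>J. \<gamma>)"
        using hm by (simp add: \<delta>_def cardJ field_simps)
      also have "\<dots> \<le> ?h / 2 * (\<Sum>j\<in>J. ?E j)"
        using h EJ by (intro mult_left_mono sum_mono) auto
      also have "\<dots> \<le> ?h / 2 * (\<Sum>j<N * 2^k. ?E j)"
        using h Jsub E0 by (intro mult_left_mono sum_mono2) auto
      also have "\<dots> \<le> expectation (\<lambda>\<omega>. ?\<phi> (grid_stop ?h T (N * 2^k) \<omega>))
          - expectation (\<lambda>\<omega>. ?\<phi> (grid_stop ?h S (N * 2^k) \<omega>))"
      proof (rule grid_stop_mono[OF S T le h, where d = "\<lambda>x. x / sqrt (1 + x\<^sup>2)" and L = 1])
        show "?\<phi> x + x / ?\<phi> x * y + c x * (y\<^sup>2 - y ^ 4) \<le> ?\<phi> (x + y)" for x y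
          unfolding c_def by (rule sqrt_one_plus_square_support)
        show "\<bar>?\<phi> x\<bar> \<le> 1 + \<bar>x\<bar>" for x using sqrt_one_plus_square_lipschitz[of x 0] by simp
        have "\<bar>x\<bar> \<le> ?\<phi> x" for x by (rule real_le_rsqrt) simp
        then show "\<bar>x / ?\<phi> x\<bar> \<le> 1" for x
          by (simp add: divide_le_eq_1 abs_divide add_pos_nonneg)
      qed (use c0 c1 in \<open>auto simp: less_imp_le\<close>)
      finally show ?thesis .
    qed
    then show "\<exists>n. \<forall>k\<ge>n. \<delta> \<le> expectation (\<lambda>\<omega>. ?\<phi> (grid_stop ((1/2)^k) T (N * 2^k) \<omega>))
      - expectation (\<lambda>\<omega>. ?\<phi> (grid_stop ((1/2)^k) S (N * 2^k) \<omega>))" by blast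
  qed
  moreover have "0 < \<delta>" using \<gamma> by (simp add: \<delta>_def)
  ultimately show ?thesis by blast
qed

end

section \<open>Hitting times of closed sets\<close>

context brownian_motion
begin

text \<open>The recursion for \<open>cw_T\<close> is the instance where \<open>D\<close> consists of
  the reals outside an open interval with extended endpoints; such a set is closed.\<close>

definition hit_after :: "('a \<Rightarrow> ennreal) \<Rightarrow> real set \<Rightarrow> 'a \<Rightarrow> ennreal" where
  "hit_after \<sigma> D \<omega> = Inf {ennreal t | t. 0 \<le> t \<and> \<sigma> \<omega> \<le> ennreal t \<and> B t \<omega> \<in> D}"

lemma hit_after_ge: "\<sigma> \<omega> \<le> hit_after \<sigma> D \<omega>"
  unfolding hit_after_def by (rule Inf_greatest) auto

lemma hit_after_le: "0 \<le> t \<Longrightarrow> \<sigma> \<omega> \<le> ennreal t \<Longrightarrow> B t \<omega> \<in> D \<Longrightarrow> hit_after \<sigma> D \<omega> \<le> ennreal t"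
  unfolding hit_after_def by (rule Inf_lower) auto

text \<open>By continuity of the path the admissible times form a closed set bounded below, so a
  finite infimum belongs to it.\<close>

lemma hit_after_attained:
  assumes D: "closed D" and \<omega>: "\<omega> \<in> space M" and fin: "hit_after \<sigma> D \<omega> < \<infinity>"
  obtains t where "0 \<le> t" "\<sigma> \<omega> \<le> ennreal t" "B t \<omega> \<in> D" "hit_after \<sigma> D \<omega> = ennreal t"
proof -
  define A where "A = {t. 0 \<le> t \<and> \<sigma> \<omega> \<le> ennreal t \<and> B t \<omega> \<in> D}"
  have H: "hit_after \<sigma> D \<omega> = Inf (ennreal ` A)"
    unfolding hit_after_def A_def by (rule arg_cong[where f = Inf]) auto
  have ne: "A \<noteq> {}"
  proof
    assume "A = {}" with fin H show False by simp
  qed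
  then have "\<sigma> \<omega> < \<infinity>" by (auto simp: A_def intro: le_less_trans)
  then have "\<sigma> \<omega> \<le> ennreal t \<longleftrightarrow> enn2real (\<sigma> \<omega>) \<le> t" if "0 \<le> t" for t
    using that by (cases "\<sigma> \<omega>" rule: ennreal_cases) (auto simp: ennreal_le_iff)
  then have "A = ({0..} \<inter> (\<lambda>t. B t \<omega>) -` D) \<inter> {enn2real (\<sigma> \<omega>)..}"
    by (auto simp: A_def)
  moreover have "closed ({0..} \<inter> (\<lambda>t. B t \<omega>) -` D)"
    by (rule continuous_closed_preimage[OF continuous_paths[OF \<omega>] _ D]) auto
  ultimately have "closed A" by auto
  moreover have "bdd_below A" by (auto simp: A_def intro!: bdd_belowI[of _ 0])
  ultimately have I: "Inf A \<in> A" using ne by (intro closed_contains_Inf)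
  have "Inf (ennreal ` A) = ennreal (Inf A)"
  proof (rule antisym)
    show "Inf (ennreal ` A) \<le> ennreal (Inf A)" using I by (rule INF_lower)
    show "ennreal (Inf A) \<le> Inf (ennreal ` A)"
      using \<open>bdd_below A\<close> by (intro INF_greatest ennreal_leI cInf_lower)
  qed
  with I H that[of "Inf A"] show thesis by (auto simp: A_def)
qed

text \<open>The right side involves countably many events, all known by time \<open>t\<close>, which
  gives adaptedness without right-continuity of the filtration. The time \<open>t\<close> is listed
  separately because a hit at exactly \<open>t\<close> may have no rational time between \<sigma>
  and \<open>t\<close> to witness it.\<close>

lemma hit_after_le_iff:
  assumes D: "closed D" "D \<noteq> {}" and \<omega>: "\<omega> \<in> space M" and t: "0 \<le> t"
  shows "hit_after \<sigma> D \<omega> \<le> ennreal t \<longleftrightarrow>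
    (\<forall>m. \<exists>r \<in> insert t ({0..t} \<inter> \<rat>). \<sigma> \<omega> \<le> ennreal r \<and> infdist (B r \<omega>) D < inverse (real (Suc m)))"
    (is "?L \<longleftrightarrow> ?R")
proof
  assume L: ?L
  then have "hit_after \<sigma> D \<omega> < \<infinity>" by (auto intro: le_less_trans)
  from hit_after_attained[OF D(1) \<omega> this] obtain s where
    s: "0 \<le> s" "\<sigma> \<omega> \<le> ennreal s" "B s \<omega> \<in> D" "hit_after \<sigma> D \<omega> = ennreal s" .
  with L t have st: "s \<le> t" by (simp add: ennreal_le_iff)
  show ?R
  proof
    fix m
    show "\<exists>r \<in> insert t ({0..t} \<inter> \<rat>). \<sigma> \<omega> \<le> ennreal r \<and> infdist (B r \<omega>) D < inverse (real (Suc m))"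
    proof (cases "s = t")
      case True
      with s show ?thesis by auto
    next
      case False
      have "continuous_on {0..} (\<lambda>r. infdist (B r \<omega>) D)"
        by (intro continuous_on_infdist continuous_paths \<omega>)
      from this[unfolded continuous_on_iff, rule_format, of s "inverse (real (Suc m))"] s
      obtain d where d: "0 < d" "\<And>r. 0 \<le> r \<Longrightarrow> dist r s < d \<Longrightarrow>
          dist (infdist (B r \<omega>) D) (infdist (B s \<omega>) D) < inverse (real (Suc m))"
        by auto
      \<comment> \<open>\<open>r\<close> is taken to the right of the hitting time \<open>s\<close>,
        so that it still lies after \<sigma>.\<close>
      obtain r where r: "r \<in> \<rat>" "s < r" "r < min t (s + d)"
        using Rats_dense_in_real[of s "min t (s + d)"] False st d by auto
      have "dist (infdist (B r \<omega>) D) (infdist (B s \<omega>) D) < inverse (real (Suc m))"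
        using r s by (intro d) (auto simp: dist_real_def)
      then have "infdist (B r \<omega>) D < inverse (real (Suc m))" using s by simp
      moreover have "\<sigma> \<omega> \<le> ennreal r" using s r by (auto intro: order_trans ennreal_leI)
      ultimately show ?thesis using r s by (intro bexI[of _ r]) auto
    qed
  qed
next
  assume ?R
  then obtain r where r: "\<And>m. r m \<in> {0..t}" "\<And>m. \<sigma> \<omega> \<le> ennreal (r m)"
      "\<And>m. infdist (B (r m) \<omega>) D < inverse (real (Suc m))"
    using t by (metis IntD1 atLeastAtMost_iff insert_iff order_refl)
  \<comment> \<open>The near-hits accumulate in a compact interval; their limit is an actual hit, by
    continuity of the path and closedness of \<open>D\<close>.\<close>
  obtain s \<rho> where s: "s \<in> {0..t}" "strict_mono \<rho>" "(r \<circ> \<rho>) \<longlonglongrightarrow> s"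
    using compact_Icc[of 0 t] r(1) unfolding compact_def by meson
  have rs: "(\<lambda>k. r (\<rho> k)) \<longlonglongrightarrow> s" using s by (simp add: comp_def)
  have "(\<lambda>k. ennreal (r (\<rho> k))) \<longlonglongrightarrow> ennreal s" using rs by (rule tendsto_ennrealI)
  then have "\<sigma> \<omega> \<le> ennreal s" by (rule LIMSEQ_le_const) (use r in auto)
  moreover have "B s \<omega> \<in> D"
  proof -
    have "(\<lambda>k. B (r (\<rho> k)) \<omega>) \<longlonglongrightarrow> B s \<omega>"
      by (rule tendsto_B[OF \<omega> rs]) (use r s in auto)
    then have 1: "(\<lambda>k. infdist (B (r (\<rho> k)) \<omega>) D) \<longlonglongrightarrow> infdist (B s \<omega>) D" by (rule tendsto_infdist)
    have "(\<lambda>k. inverse (real (Suc (\<rho> k)))) \<longlonglongrightarrow> 0"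
      using LIMSEQ_subseq_LIMSEQ[OF LIMSEQ_inverse_real_of_nat s(2)] by (simp add: comp_def)
    from LIMSEQ_le[OF 1 this] have "infdist (B s \<omega>) D \<le> 0" using r(3) by (auto intro: less_imp_le)
    then show ?thesis using D in_closed_iff_infdist_zero[of D "B s \<omega>"] infdist_nonneg[of "B s \<omega>" D] by auto
  qed
  ultimately have "hit_after \<sigma> D \<omega> \<le> ennreal s" using s by (intro hit_after_le) auto
  also have "\<dots> \<le> ennreal t" using s by (auto intro: ennreal_leI)
  finally show ?L .
qed

lemma stopping_time_hit_after:
  assumes \<sigma>: "stopping_time F \<sigma>" and D: "closed D"
  shows "stopping_time F (hit_after \<sigma> D)"
proof
  fix t :: ennreal
  show "Measurable.pred (F t) (\<lambda>\<omega>. hit_after \<sigma> D \<omega> \<le> t)"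
  proof (cases t rule: ennreal_cases)
    case (real u)
    show ?thesis
    proof (cases "D = {}")
      \<comment> \<open>\<open>infdist\<close> to the empty set is 0 by convention, so the
        characterisation does not cover \<open>D = {}\<close>.\<close>
      case True
      then have "hit_after \<sigma> D \<omega> = \<infinity>" for \<omega> by (simp add: hit_after_def)
      then show ?thesis using real by simp
    next
      case False
      have cnt: "countable (insert u ({0..u} \<inter> \<rat>))" using countable_rat by auto
      have "Measurable.pred (F t) (\<lambda>\<omega>. \<sigma> \<omega> \<le> ennreal r \<and> infdist (B r \<omega>) D < inverse (real (Suc m)))"
        if "r \<in> insert u ({0..u} \<inter> \<rat>)" for r m
      proof -
        have r: "0 \<le> r" "ennreal r \<le> t" using that real by (auto intro: ennreal_leI)
        have [measurable]: "B r \<in> borel_measurable (F t)" by (rule measurable_F[OF adapted[OF r(1)] r(2)])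
        have [measurable]: "Measurable.pred (F t) (\<lambda>\<omega>. \<sigma> \<omega> \<le> ennreal r)"
          by (rule stopping_time_le_const[OF \<sigma> r(2)])
        have [measurable]: "(\<lambda>x. infdist x D) \<in> borel_measurable borel"
          by (intro borel_measurable_continuous_onI continuous_on_infdist continuous_intros)
        show ?thesis by measurable
      qed
      then have "Measurable.pred (F t) (\<lambda>\<omega>. \<forall>m. \<exists>r \<in> insert u ({0..u} \<inter> \<rat>).
          \<sigma> \<omega> \<le> ennreal r \<and> infdist (B r \<omega>) D < inverse (real (Suc m)))"
        unfolding pred_def
        by (intro sets.sets_Collect_countable_All sets.sets_Collect_countable_Ex'[OF _ cnt])
      moreover have "hit_after \<sigma> D \<omega> \<le> t \<longleftrightarrow> (\<forall>m. \<exists>r \<in> insert u ({0..u} \<inter> \<rat>).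
          \<sigma> \<omega> \<le> ennreal r \<and> infdist (B r \<omega>) D < inverse (real (Suc m)))" if "\<omega> \<in> space (F t)" for \<omega>
        using hit_after_le_iff[OF D False, of \<omega> u] that real by (simp add: space_F)
      ultimately show ?thesis by (subst measurable_cong)
    qed
  qed simp
qed

text \<open>Either the stopped time does not move, or the path stays inside \<open>(a, b)\<close>
  from \<sigma> until just before the later time, and its value there is a limit from the left. In
  the second case both values lie on the same side of any \<open>z\<close> outside
  \<open>(a, b)\<close>.\<close>

lemma stop_at_exit_interval:
  fixes \<sigma> :: "'a \<Rightarrow> ennreal" and a b :: ereal
  assumes \<omega>: "\<omega> \<in> space M"
  defines "\<tau> \<equiv> hit_after \<sigma> {x. ereal x \<notin> {a<..<b}}"
  shows "stop_at N \<tau> \<omega> = stop_at N \<sigma> \<omega> \<or>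
    (a \<le> ereal (stop_at N \<sigma> \<omega>) \<and> ereal (stop_at N \<sigma> \<omega>) \<le> b \<and> a \<le> ereal (stop_at N \<tau> \<omega>) \<and> ereal (stop_at N \<tau> \<omega>) \<le> b)"
proof (cases "ennreal (real N) \<le> \<sigma> \<omega> \<or> \<tau> \<omega> = \<sigma> \<omega>")
  case True
  have "\<sigma> \<omega> \<le> \<tau> \<omega>" unfolding \<tau>_def by (rule hit_after_ge)
  with True have "min (\<tau> \<omega>) (ennreal (real N)) = min (\<sigma> \<omega>) (ennreal (real N))"
    by (auto simp: min_def)
  then show ?thesis by (simp add: stop_at_def)
next
  case False
  have "\<sigma> \<omega> \<le> \<tau> \<omega>" unfolding \<tau>_def by (rule hit_after_ge)
  with False have lt: "\<sigma> \<omega> < min (\<tau> \<omega>) (ennreal (real N))" by auto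
  define s where "s = enn2real (\<sigma> \<omega>)"
  define u where "u = enn2real (min (\<tau> \<omega>) (ennreal (real N)))"
  have \<sigma>s: "\<sigma> \<omega> = ennreal s" using lt unfolding s_def by (intro ennreal_enn2real[symmetric]) (use less_le_trans[OF lt, of top] in simp)
  have mu: "min (\<tau> \<omega>) (ennreal (real N)) = ennreal u"
    unfolding u_def by (intro ennreal_enn2real[symmetric]) (auto simp: min_less_iff_disj)
  have s0: "0 \<le> s" "0 \<le> u" by (auto simp: s_def u_def)
  have su: "s < u" using lt unfolding mu \<sigma>s by (simp add: ennreal_less_iff s0)
  have ins: "a < ereal (B r \<omega>) \<and> ereal (B r \<omega>) < b" if "s \<le> r" "r < u" for r
  proof (rule ccontr)
    assume "\<not> (a < ereal (B r \<omega>) \<and> ereal (B r \<omega>) < b)"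
    then have "\<tau> \<omega> \<le> ennreal r" unfolding \<tau>_def
      using that s0 \<sigma>s by (intro hit_after_le) (auto intro: ennreal_leI)
    then have "ennreal u \<le> ennreal r" unfolding mu[symmetric] by (simp add: min.coboundedI1)
    then show False using that s0 by (simp add: ennreal_le_iff)
  qed
  have st\<sigma>: "stop_at N \<sigma> \<omega> = B s \<omega>"
    using lt by (auto simp: stop_at_def s_def intro!: arg_cong[where f = "\<lambda>x. B (enn2real x) \<omega>"] min_absorb1 less_imp_le)
  have st\<tau>: "stop_at N \<tau> \<omega> = B u \<omega>" by (simp add: stop_at_def u_def)
  \<comment> \<open>Explicit times in \<open>[s, u)\<close> tending to \<open>u\<close>: along them
    the path lies in the open interval, so its limit lies in the closed one.\<close>
  have "(\<lambda>k. u - (u - s) * inverse (real (Suc k))) \<longlonglongrightarrow> u - (u - s) * 0"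
    by (intro tendsto_intros LIMSEQ_inverse_real_of_nat)
  then have lim: "(\<lambda>k. u - (u - s) * inverse (real (Suc k))) \<longlonglongrightarrow> u" by simp
  have rng: "s \<le> u - (u - s) * inverse (real (Suc k))" "u - (u - s) * inverse (real (Suc k)) < u" for k
  proof -
    have "inverse (real (Suc k)) \<le> 1" by (simp add: field_simps)
    then have "(u - s) * inverse (real (Suc k)) \<le> u - s" using su by (intro mult_left_le) auto
    then show "s \<le> u - (u - s) * inverse (real (Suc k))" by simp
  qed (use su in simp)
  have limB: "(\<lambda>k. B (u - (u - s) * inverse (real (Suc k))) \<omega>) \<longlonglongrightarrow> B u \<omega>"
    by (rule tendsto_B[OF \<omega> lim]) (use order_trans[OF s0(1) rng(1)] s0 in auto)
  have limE: "(\<lambda>k. ereal (B (u - (u - s) * inverse (real (Suc k))) \<omega>)) \<longlonglongrightarrow> ereal (B u \<omega>)"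
    using limB by simp
  have "a \<le> ereal (B u \<omega>)" "ereal (B u \<omega>) \<le> b"
    by (rule LIMSEQ_le_const[OF limE] LIMSEQ_le_const2[OF limE]; use ins[OF rng] in \<open>blast intro: less_imp_le\<close>)+
  with ins[of s] su st\<sigma> st\<tau> show ?thesis by (auto intro: less_imp_le)
qed

lemma tendsto_stop_at:
  assumes \<omega>: "\<omega> \<in> space M" and lim: "(\<lambda>n. \<tau> n \<omega>) \<longlonglongrightarrow> T \<omega>"
  shows "(\<lambda>n. stop_at N (\<tau> n) \<omega>) \<longlonglongrightarrow> stop_at N T \<omega>"
  unfolding stop_at_def
proof (rule tendsto_B[OF \<omega>])
  have "(\<lambda>n. min (\<tau> n \<omega>) (ennreal (real N))) \<longlonglongrightarrow> min (T \<omega>) (ennreal (real N))"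
    by (intro tendsto_min lim tendsto_const)
  then show "(\<lambda>n. enn2real (min (\<tau> n \<omega>) (ennreal (real N)))) \<longlonglongrightarrow> enn2real (min (T \<omega>) (ennreal (real N)))"
    by (intro tendsto_enn2real) (auto simp: ennreal_enn2real min_less_iff_disj)
qed auto

lemma tendsto_stop_at_stopped_value:
  assumes "T \<omega> < \<infinity>"
  shows "(\<lambda>N. stop_at N T \<omega>) \<longlonglongrightarrow> stopped_value B T \<omega>"
proof (rule tendsto_eventually)
  obtain u where u: "T \<omega> = ennreal u" "0 \<le> u" using assms by (cases "T \<omega>" rule: ennreal_cases) auto
  obtain N0 where "u \<le> real N0" using real_arch_simple by blast
  then have "min (T \<omega>) (ennreal (real N)) = T \<omega>" if "N0 \<le> N" for N
    using that u by (intro min_absorb1) (auto intro!: ennreal_leI)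
  then show "\<forall>\<^sub>F N in sequentially. stop_at N T \<omega> = stopped_value B T \<omega>"
    unfolding eventually_sequentially stop_at_def stopped_value_def by (intro exI[of _ N0]) auto
qed

lemma measurable_stopping_time_M: "stopping_time F T \<Longrightarrow> T \<in> borel_measurable M"
  by (rule measurable_stopping_time[OF _ sets_F_subset space_F])

lemma measurable_stopped_value:
  assumes T: "stopping_time F T"
  shows "stopped_value B T \<in> borel_measurable M"
proof (rule borel_measurable_LIMSEQ_real)
  fix \<omega>
  \<comment> \<open>Where \<open>T = \<infinity>\<close> the values \<open>stop_at N T\<close> may
    diverge, so the approximation is set to \<open>B 0\<close> there, the default of
    \<open>stopped_value\<close>.\<close>
  show "(\<lambda>N. if T \<omega> = \<infinity> then B 0 \<omega> else stop_at N T \<omega>) \<longlonglongrightarrow> stopped_value B T \<omega>"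
    using tendsto_stop_at_stopped_value[of T \<omega>]
    by (cases "T \<omega> = \<infinity>") (simp_all add: stopped_value_def less_top[symmetric])
next
  note [measurable] = measurable_stopping_time_M[OF T] measurable_stop_at[OF T] measurable_B[OF order_refl]
  show "(\<lambda>\<omega>. if T \<omega> = \<infinity> then B 0 \<omega> else stop_at N T \<omega>) \<in> borel_measurable M" for N
    by measurable
qed

end

section \<open>A criterion for minimality\<close>

text \<open>Where \<open>T\<close> is finite, this covers the event \<open>S < T\<close> by the
  countably many cell events of \<open>stop_at_strict_mono\<close>.\<close>

lemma exists_dyadic_cell:
  fixes s t :: real
  assumes "0 \<le> s" "s < t"
  shows "\<exists>m i :: nat. s \<le> real i * (1/2)^m \<and> real (Suc i) * (1/2)^m \<le> t"
proof -
  \<comment> \<open>Rounding \<open>s\<close> up costs at most one cell width and the cell itself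
    another, so twice the width must fit between \<open>s\<close> and \<open>t\<close>.\<close>
  obtain m where m: "(1/2::real)^m < (t - s) / 2"
    using real_arch_pow_inv[of "(t - s) / 2" "1/2"] assms by auto
  define w where "w = (1/2::real)^m"
  have p: "2^m * w = 1" by (simp add: w_def power_one_over)
  have w0: "0 \<le> w" by (simp add: w_def)
  define i where "i = nat \<lceil>s * 2^m\<rceil>"
  have i: "s * 2^m \<le> real i" "real i \<le> s * 2^m + 1"
    using assms(1) by (auto simp: i_def of_nat_ceiling)
  have "s * 2^m * w \<le> real i * w" by (rule mult_right_mono[OF i(1) w0])
  then have 1: "s \<le> real i * w" using p by (simp add: mult.assoc)
  have "real i * w \<le> (s * 2^m + 1) * w" by (rule mult_right_mono[OF i(2) w0])
  also have "\<dots> = s + w" using p by (simp add: ring_distribs mult.assoc)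
  finally have "real (Suc i) * w \<le> s + w + w" by (simp add: ring_distribs)
  then have "real (Suc i) * w \<le> t" using m unfolding w_def[symmetric] by simp
  with 1 show ?thesis unfolding w_def by blast
qed

context integrable_brownian_motion
begin

text \<open>If \<open>S\<close> differed from \<open>T\<close>, the mean of
  \<open>sqrt (1 + x\<^sup>2)\<close> would gain a fixed \<delta> between the two. By
  \<open>loc\<close> the mean of \<open>\<bar>x - z\<bar>\<close> gains at most half of that, while
  equality of laws forces the two gains to agree in the limit.\<close>

lemma minimal_stopping_timeI:
  assumes T: "stopping_time F T" and fin: "AE \<omega> in M. T \<omega> < \<infinity>"
    and loc: "\<And>\<delta>. 0 < \<delta> \<Longrightarrow> \<exists>z. \<forall>N. expectation (\<lambda>\<omega>. \<bar>stop_at N T \<omega> - z\<bar>) \<le> expectation (\<lambda>\<omega>. \<bar>B 0 \<omega> - z\<bar>) + \<delta>"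
  shows "minimal_stopping_time M F B T"
  unfolding minimal_stopping_time_def
proof (intro conjI allI impI T fin, elim conjE)
  fix R assume R: "stopping_time F R" "AE \<omega> in M. R \<omega> \<le> T \<omega>"
    and law: "distr M borel (stopped_value B R) = distr M borel (stopped_value B T)"
  \<comment> \<open>\<open>R\<close> is below \<open>T\<close> only almost surely; the minimum is
    below it everywhere, as the comparison lemmas require.\<close>
  define S where "S = (\<lambda>\<omega>. min (R \<omega>) (T \<omega>))"
  have S: "stopping_time F S" unfolding S_def by (rule stopping_time_min[OF R(1) T])
  have ST: "S \<omega> \<le> T \<omega>" for \<omega> by (simp add: S_def)
  have SR: "AE \<omega> in M. S \<omega> = R \<omega>" using R(2) by eventually_elim (simp add: S_def)
  have finS: "AE \<omega> in M. S \<omega> < \<infinity>" using fin by eventually_elim (simp add: S_def min_less_iff_disj)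
  note [measurable] = measurable_stopped_value[OF S] measurable_stopped_value[OF T] measurable_stopped_value[OF R(1)]
  \<comment> \<open>Each of the two terms grows linearly but the difference is bounded, so dominated
    convergence applies as \<open>N\<close> tends to infinity.\<close>
  let ?g = "\<lambda>z x::real. sqrt (1 + x\<^sup>2) - \<bar>x - z\<bar>"
  have g_bd: "\<bar>?g z x\<bar> \<le> 1 + \<bar>z\<bar>" for z x
    using sqrt_one_plus_square_lipschitz[of x 0] real_le_rsqrt[of "\<bar>x\<bar>" "1 + x\<^sup>2"] by simp
  have lim: "(\<lambda>N. expectation (\<lambda>\<omega>. ?g z (stop_at N U \<omega>))) \<longlonglongrightarrow> expectation (\<lambda>\<omega>. ?g z (stopped_value B U \<omega>))"
    if U: "stopping_time F U" "AE \<omega> in M. U \<omega> < \<infinity>" for U z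
  proof (rule integral_dominated_convergence[where w = "\<lambda>_. 1 + \<bar>z\<bar>"])
    note [measurable] = measurable_stopped_value[OF U(1)] measurable_stop_at[OF U(1)]
    show "(\<lambda>\<omega>. ?g z (stopped_value B U \<omega>)) \<in> borel_measurable M"
      "(\<lambda>\<omega>. ?g z (stop_at N U \<omega>)) \<in> borel_measurable M" for N by measurable
    show "AE \<omega> in M. (\<lambda>N. ?g z (stop_at N U \<omega>)) \<longlonglongrightarrow> ?g z (stopped_value B U \<omega>)"
      using U(2) by eventually_elim (intro tendsto_intros tendsto_stop_at_stopped_value)
    show "AE \<omega> in M. norm (?g z (stop_at N U \<omega>)) \<le> 1 + \<bar>z\<bar>" for N using g_bd by auto
  qed simp
  have eq: "expectation (\<lambda>\<omega>. ?g z (stopped_value B S \<omega>)) = expectation (\<lambda>\<omega>. ?g z (stopped_value B T \<omega>))" for z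
  proof -
    have "expectation (\<lambda>\<omega>. ?g z (stopped_value B S \<omega>)) = expectation (\<lambda>\<omega>. ?g z (stopped_value B R \<omega>))"
    proof (rule integral_cong_AE)
      show "AE \<omega> in M. ?g z (stopped_value B S \<omega>) = ?g z (stopped_value B R \<omega>)"
        using SR by eventually_elim (simp add: stopped_value_def)
    qed measurable
    also have "\<dots> = (\<integral>x. ?g z x \<partial>distr M borel (stopped_value B R))"
      by (rule integral_distr[symmetric]) measurable
    also have "\<dots> = expectation (\<lambda>\<omega>. ?g z (stopped_value B T \<omega>))"
      unfolding law by (rule integral_distr) measurable
    finally show ?thesis .
  qed
  have cell: "prob {\<omega> \<in> space M. S \<omega> \<le> ennreal (real i * (1/2)^m) \<and> ennreal (real (Suc i) * (1/2)^m) \<le> T \<omega>} = 0"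
    (is "prob ?A = 0") for i m
  proof (rule ccontr)
    assume "prob ?A \<noteq> 0"
    then have "0 < prob ?A" using measure_nonneg[of M ?A] by linarith
    from stop_at_strict_mono[OF S T ST this] obtain \<delta> where \<delta>: "0 < \<delta>"
      "\<And>N. Suc i \<le> N \<Longrightarrow> \<delta> \<le> expectation (\<lambda>\<omega>. sqrt (1 + (stop_at N T \<omega>)\<^sup>2))
        - expectation (\<lambda>\<omega>. sqrt (1 + (stop_at N S \<omega>)\<^sup>2))" by blast
    from loc[of "\<delta> / 2"] \<delta>(1) obtain z where z:
      "\<And>N. expectation (\<lambda>\<omega>. \<bar>stop_at N T \<omega> - z\<bar>) \<le> expectation (\<lambda>\<omega>. \<bar>B 0 \<omega> - z\<bar>) + \<delta> / 2" by auto
    have "(\<lambda>N. expectation (\<lambda>\<omega>. ?g z (stop_at N T \<omega>)) - expectation (\<lambda>\<omega>. ?g z (stop_at N S \<omega>))) \<longlonglongrightarrow> 0"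
      using tendsto_diff[OF lim[OF T fin, of z] lim[OF S finS, of z]] eq[of z] by simp
    moreover have "\<delta> / 2 \<le> expectation (\<lambda>\<omega>. ?g z (stop_at N T \<omega>)) - expectation (\<lambda>\<omega>. ?g z (stop_at N S \<omega>))"
      if N: "Suc i \<le> N" for N
    proof -
      have g_eq: "expectation (\<lambda>\<omega>. ?g z (stop_at N U \<omega>))
          = expectation (\<lambda>\<omega>. sqrt (1 + (stop_at N U \<omega>)\<^sup>2)) - expectation (\<lambda>\<omega>. \<bar>stop_at N U \<omega> - z\<bar>)"
        if "stopping_time F U" for U
        using expectation_grid_stop_tendsto(1)[OF that sqrt_one_plus_square_lipschitz, of N]
          integrable_stop_at[OF that, of N]
        by (intro Bochner_Integration.integral_diff) auto
      \<comment> \<open>The growth between \<open>S\<close> and \<open>T\<close> is at most the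
        growth between 0 and \<open>T\<close>, which is at most \<open>\<delta> / 2\<close> by the
        choice of \<open>z\<close>.\<close>
      have "expectation (\<lambda>\<omega>. \<bar>B 0 \<omega> - z\<bar>) \<le> expectation (\<lambda>\<omega>. \<bar>stop_at N S \<omega> - z\<bar>)"
        using expectation_abs_stop_at_mono[OF stopping_time_const S, of 0 N z] by simp
      with \<delta>(2)[OF N] z[of N] show ?thesis unfolding g_eq[OF S] g_eq[OF T] by linarith
    qed
    ultimately have "\<delta> / 2 \<le> 0" by (intro LIMSEQ_le_const) blast+
    with \<delta> show False by simp
  qed
  have "AE \<omega> in M. \<not> (S \<omega> \<le> ennreal (real i * (1/2)^m) \<and> ennreal (real (Suc i) * (1/2)^m) \<le> T \<omega>)" for i m
  proof (rule AE_I[OF _ _ ])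
    note [measurable] = measurable_stopping_time_M[OF S] measurable_stopping_time_M[OF T]
    let ?A = "{\<omega> \<in> space M. S \<omega> \<le> ennreal (real i * (1/2)^m) \<and> ennreal (real (Suc i) * (1/2)^m) \<le> T \<omega>}"
    show "?A \<in> sets M" by measurable
    show "emeasure M ?A = 0" using cell[of i m] by (simp add: emeasure_eq_measure)
  qed auto
  then have "AE \<omega> in M. \<forall>i m. \<not> (S \<omega> \<le> ennreal (real i * (1/2)^m) \<and> ennreal (real (Suc i) * (1/2)^m) \<le> T \<omega>)"
    by (simp add: AE_all_countable)
  with fin SR show "AE \<omega> in M. R \<omega> = T \<omega>"
  proof eventually_elim
    case (elim \<omega>)
    show ?case
    proof (rule ccontr)
      assume "R \<omega> \<noteq> T \<omega>"
      with ST[of \<omega>] elim have lt: "S \<omega> < T \<omega>" by (simp add: less_le)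
      obtain t where t: "0 \<le> t" "T \<omega> = ennreal t" using elim(1) by (cases "T \<omega>" rule: ennreal_cases) auto
      obtain s where s: "0 \<le> s" "S \<omega> = ennreal s" using lt t by (cases "S \<omega>" rule: ennreal_cases) auto
      have "s < t" using lt s t by (simp add: ennreal_less_iff)
      from exists_dyadic_cell[OF s(1) this] obtain m i :: nat where
        "s \<le> real i * (1/2)^m" "real (Suc i) * (1/2)^m \<le> t" by blast
      with elim(3) s t show False by (auto intro: ennreal_leI simp del: of_nat_Suc)
    qed
  qed
qed

text \<open>On the event \<open>T = \<infinity>\<close> the stopped process is \<open>B\<close>
  itself at time \<open>N\<close>, which leaves every bounded range in probability since its
  increments spread at scale \<open>sqrt N\<close>. A bounded first absolute moment then forces the
  event to be null.\<close>

lemma AE_finite_of_bounded: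
  assumes T: "stopping_time F T" and bd: "\<And>N. expectation (\<lambda>\<omega>. \<bar>stop_at N T \<omega>\<bar>) \<le> K"
  shows "AE \<omega> in M. T \<omega> < \<infinity>"
proof -
  note [measurable] = measurable_stopping_time_M[OF T] measurable_B[OF order_refl]
  define A where "A = {\<omega> \<in> space M. T \<omega> = \<infinity>}"
  have A[measurable]: "A \<in> sets M" unfolding A_def by measurable
  have iA: "integrable M (indicator A :: 'a \<Rightarrow> real)" "expectation (indicator A) = prob A"
    using A sets.sets_into_space[OF A] by (auto simp: emeasure_finite less_top[symmetric] Int_absorb2)
  define K2 where "K2 = K + expectation (\<lambda>\<omega>. \<bar>B 0 \<omega>\<bar>)"
  \<comment> \<open>\<open>A\<close> is split by whether the increment over \<open>[0, N]\<close>
    stays within \<open>R\<close>: the first part is small because the normal density is at most its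
    value at 0, the second by Markov's inequality.\<close>
  have main: "prob A \<le> 2 * R / sqrt (2 * pi) * inverse (sqrt (real (Suc n))) + K2 / R" if R: "0 < R" for R n
  proof -
    let ?N = "Suc n"
    let ?D = "\<lambda>\<omega>. B (real ?N) \<omega> - B 0 \<omega>"
    have N: "0 < real ?N" by simp
    have [measurable]: "B (real ?N) \<in> borel_measurable M" by (rule measurable_B) simp
    define G where "G = ?D -` {-R..R} \<inter> space M"
    have G[measurable]: "G \<in> sets M" unfolding G_def by measurable
    have iG: "integrable M (indicator G :: 'a \<Rightarrow> real)" "expectation (indicator G) = prob G"
      using G sets.sets_into_space[OF G] by (auto simp: emeasure_finite less_top[symmetric] Int_absorb2)
    have "emeasure M G = (\<integral>\<^sup>+x. ennreal (normal_density 0 (sqrt (real ?N - 0)) x) * indicator {-R..R} x \<partial>lborel)"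
      unfolding G_def by (rule distributed_emeasure[OF gaussian_increments[OF order_refl N]]) simp
    also have "\<dots> \<le> (\<integral>\<^sup>+x. ennreal (1 / sqrt (2 * pi * real ?N)) * indicator {-R..R} x \<partial>lborel)"
    proof (intro nn_integral_mono mult_right_mono ennreal_leI)
      fix x
      have "1 / sqrt (2 * pi * real ?N) * exp (- (x - 0)\<^sup>2 / (2 * real ?N)) \<le> 1 / sqrt (2 * pi * real ?N)"
        by (rule mult_left_le) auto
      then show "normal_density 0 (sqrt (real ?N - 0)) x \<le> 1 / sqrt (2 * pi * real ?N)"
        by (simp add: normal_density_def)
    qed simp
    also have "\<dots> = ennreal (1 / sqrt (2 * pi * real ?N) * (2 * R))"
      using R by (simp add: nn_integral_cmult_indicator ennreal_mult[symmetric])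
    finally have "prob G \<le> 1 / sqrt (2 * pi * real ?N) * (2 * R)"
      using R by (simp add: emeasure_eq_measure ennreal_le_iff)
    also have "\<dots> = 2 * R / sqrt (2 * pi) * inverse (sqrt (real ?N))"
      unfolding real_sqrt_mult[of "2 * pi"] by (simp add: divide_inverse)
    finally have G_le: "prob G \<le> 2 * R / sqrt (2 * pi) * inverse (sqrt (real ?N))" .
    have iS: "integrable M (\<lambda>\<omega>. \<bar>stop_at ?N T \<omega>\<bar>)" "integrable M (\<lambda>\<omega>. \<bar>B 0 \<omega>\<bar>)"
      using integrable_stop_at[OF T] integrable_B0 by auto
    have "prob A = expectation (indicator A)" using iA by simp
    also have "\<dots> \<le> expectation (\<lambda>\<omega>. indicator G \<omega> + (\<bar>stop_at ?N T \<omega>\<bar> + \<bar>B 0 \<omega>\<bar>) / R)"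
    proof (rule integral_mono)
      fix \<omega> assume \<omega>: "\<omega> \<in> space M"
      have nn: "0 \<le> (\<bar>stop_at ?N T \<omega>\<bar> + \<bar>B 0 \<omega>\<bar>) / R" using R by simp
      show "indicator A \<omega> \<le> indicator G \<omega> + (\<bar>stop_at ?N T \<omega>\<bar> + \<bar>B 0 \<omega>\<bar>) / R"
      proof (cases "\<omega> \<in> A \<and> \<omega> \<notin> G")
        case True
        then have "stop_at ?N T \<omega> = B (real ?N) \<omega>" by (simp add: stop_at_def A_def del: of_nat_Suc)
        moreover have "R < \<bar>?D \<omega>\<bar>" using True \<omega> by (auto simp: G_def)
        ultimately have "R \<le> \<bar>stop_at ?N T \<omega>\<bar> + \<bar>B 0 \<omega>\<bar>" by linarith
        then have "1 \<le> (\<bar>stop_at ?N T \<omega>\<bar> + \<bar>B 0 \<omega>\<bar>) / R" using R by simp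
        with True show ?thesis by simp
      next
        case False
        with nn show ?thesis by (auto simp: indicator_def)
      qed
    qed (use iS iA iG in auto)
    also have "\<dots> = prob G + (expectation (\<lambda>\<omega>. \<bar>stop_at ?N T \<omega>\<bar>) + expectation (\<lambda>\<omega>. \<bar>B 0 \<omega>\<bar>)) / R"
      using iS iG by simp
    also have "\<dots> \<le> 2 * R / sqrt (2 * pi) * inverse (sqrt (real ?N)) + K2 / R"
      using G_le bd[of ?N] R unfolding K2_def by (intro add_mono divide_right_mono) auto
    finally show ?thesis .
  qed
  \<comment> \<open>First \<open>n\<close> tends to infinity with \<open>R\<close> fixed, afterwards
    \<open>R\<close> does.\<close>
  have "prob A \<le> K2 / R" if R: "0 < R" for R
  proof (rule LIMSEQ_le_const)
    have "filterlim (\<lambda>n. real (Suc n)) at_top sequentially"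
      using filterlim_real_sequentially by (rule filterlim_compose) (rule filterlim_Suc)
    then have "(\<lambda>n. inverse (sqrt (real (Suc n)))) \<longlonglongrightarrow> 0"
      by (intro tendsto_inverse_0_at_top filterlim_compose[OF sqrt_at_top])
    then have "(\<lambda>n. 2 * R / sqrt (2 * pi) * inverse (sqrt (real (Suc n))) + K2 / R)
      \<longlonglongrightarrow> 2 * R / sqrt (2 * pi) * 0 + K2 / R" by (intro tendsto_intros)
    then show "(\<lambda>n. 2 * R / sqrt (2 * pi) * inverse (sqrt (real (Suc n))) + K2 / R) \<longlonglongrightarrow> K2 / R" by simp
    show "\<exists>N. \<forall>n\<ge>N. prob A \<le> 2 * R / sqrt (2 * pi) * inverse (sqrt (real (Suc n))) + K2 / R"
      using main[OF R] by blast
  qed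
  from this[of "real (Suc n)" for n] have "prob A \<le> K2 * inverse (real (Suc n))" for n
    by (simp add: divide_inverse del: of_nat_Suc)
  moreover have "(\<lambda>n. K2 * inverse (real (Suc n))) \<longlonglongrightarrow> K2 * 0"
    by (intro tendsto_intros LIMSEQ_inverse_real_of_nat)
  ultimately have "prob A \<le> K2 * 0" by (intro LIMSEQ_le_const) blast+
  then have "emeasure M A = 0" using measure_nonneg[of M A] by (simp add: emeasure_eq_measure)
  then show ?thesis
    by (intro AE_I[of _ _ A]) (use A in \<open>auto simp: A_def less_top[symmetric]\<close>)
qed

end

section \<open>The embedding\<close>

text \<open>The triangle inequality, with \<open>z\<close> written as a convex combination of
  \<open>a\<close> and \<open>b\<close>.\<close>

lemma interval_abs_convex:
  fixes a b x z :: real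
  assumes "a < z" "z < b"
  shows "\<bar>x - z\<bar> \<le> (b - z) / (b - a) * \<bar>x - a\<bar> + (z - a) / (b - a) * \<bar>x - b\<bar>"
proof -
  have "(b - a) * (x - z) = (b - z) * (x - a) + (z - a) * (x - b)" by (simp add: algebra_simps)
  then have "\<bar>(b - a) * (x - z)\<bar> = \<bar>(b - z) * (x - a) + (z - a) * (x - b)\<bar>" by simp
  also have "\<dots> \<le> (b - z) * \<bar>x - a\<bar> + (z - a) * \<bar>x - b\<bar>"
    using assms abs_triangle_ineq[of "(b - z) * (x - a)" "(z - a) * (x - b)"] by (simp add: abs_mult)
  finally have "(b - a) * \<bar>x - z\<bar> \<le> (b - z) * \<bar>x - a\<bar> + (z - a) * \<bar>x - b\<bar>"
    using assms by (simp add: abs_mult)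
  then have "\<bar>x - z\<bar> \<le> ((b - z) * \<bar>x - a\<bar> + (z - a) * \<bar>x - b\<bar>) / (b - a)"
    using assms by (simp add: pos_le_divide_eq mult.commute)
  then show ?thesis by (simp add: add_divide_distrib)
qed

text \<open>Membership in the closure transfers the inequality between \<open>f n\<close> and the
  preceding \<open>cw_g\<close> to a finite endpoint, by continuity. A finite infimum rules out
  \<open>U = {}\<close>, whose infimum is \<infinity>.\<close>

lemma Inf_ereal_image_in_closure:
  assumes "ereal a = Inf (ereal ` U)"
  shows "a \<in> closure U"
proof -
  have ne: "U \<noteq> {}" using assms by (auto simp: top_ereal_def bot_ereal_def)
  have lb: "a \<le> x" if "x \<in> U" for x
    using that assms by (metis INF_lower ereal_less_eq(3))
  have "a = Inf U"
  proof (rule cInf_eq_non_empty[OF ne, symmetric])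
    fix y assume "\<And>x. x \<in> U \<Longrightarrow> y \<le> x"
    then have "ereal y \<le> ereal a" unfolding assms by (intro INF_greatest) simp
    then show "y \<le> a" by simp
  qed (fact lb)
  then show ?thesis using ne lb by (auto intro!: closure_contains_Inf bdd_belowI)
qed

lemma Sup_ereal_image_in_closure:
  assumes "ereal b = Sup (ereal ` U)"
  shows "b \<in> closure U"
proof -
  have ne: "U \<noteq> {}" using assms by (auto simp: top_ereal_def bot_ereal_def)
  have ub: "x \<le> b" if "x \<in> U" for x
    using that assms by (metis SUP_upper ereal_less_eq(3))
  have "b = Sup U"
  proof (rule cSup_eq_non_empty[OF ne, symmetric])
    fix y assume "\<And>x. x \<in> U \<Longrightarrow> x \<le> y"
    then have "ereal b \<le> ereal y" unfolding assms by (intro SUP_least) simp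
    then show "b \<le> y" by simp
  qed (fact ub)
  then show ?thesis using ne ub by (auto intro!: closure_contains_Sup bdd_aboveI)
qed

text \<open>The inequality \<open>p * x + q < c + x\<close> holds for arbitrarily negative
  \<open>x\<close> and bounds \<open>(1 - p) * x\<close> from below, which is impossible for
  \<open>p < 1\<close>. In the proof, \<open>K\<close> is the point where \<open>(1 - p) * x\<close>
  equals \<open>- \<bar>c - q\<bar>\<close>.\<close>

lemma slope_one_if_below_at_bot:
  fixes p q c :: real
  assumes U: "Inf (ereal ` {x. p * x + q < g x}) = -\<infinity>" and g: "\<And>x. g x \<le> c - \<bar>x\<bar>" and p: "p \<le> 1"
  shows "p = 1"
proof (rule ccontr)
  assume "p \<noteq> 1" with p have p1: "0 < 1 - p" by simp
  define K where "K = - \<bar>c - q\<bar> / (1 - p)"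
  have K0: "K \<le> 0" using p1 by (simp add: K_def)
  have "Inf (ereal ` {x. p * x + q < g x}) < ereal K" using U by simp
  then obtain x where x: "p * x + q < g x" "x < K" by (auto simp: Inf_less_iff)
  then have "x * (1 - p) < K * (1 - p)" using p1 by (intro mult_strict_right_mono)
  also have "K * (1 - p) = - \<bar>c - q\<bar>" using p1 by (simp add: K_def)
  finally have "x * (1 - p) < - \<bar>c - q\<bar>" .
  moreover have "p * x + q < c + x" using x g[of x] K0 by linarith
  ultimately show False by (simp add: algebra_simps)
qed

lemma slope_minus_one_if_below_at_top:
  fixes p q c :: real
  assumes U: "Sup (ereal ` {x. p * x + q < g x}) = \<infinity>" and g: "\<And>x. g x \<le> c - \<bar>x\<bar>" and p: "- 1 \<le> p"
  shows "p = - 1"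
proof (rule ccontr)
  assume "p \<noteq> - 1" with p have p1: "0 < 1 + p" by simp
  define K where "K = \<bar>c - q\<bar> / (1 + p)"
  have K0: "0 \<le> K" using p1 by (simp add: K_def)
  have "ereal K < Sup (ereal ` {x. p * x + q < g x})" using U by simp
  then obtain x where x: "p * x + q < g x" "K < x" by (auto simp: less_Sup_iff)
  then have "K * (1 + p) < x * (1 + p)" using p1 by (intro mult_strict_right_mono)
  also have "K * (1 + p) = \<bar>c - q\<bar>" using p1 by (simp add: K_def)
  finally have "\<bar>c - q\<bar> < x * (1 + p)" .
  moreover have "p * x + q < c - x" using x g[of x] K0 by linarith
  ultimately show False by (simp add: algebra_simps)
qed

section \<open>Exit from a single interval\<close>

context integrable_brownian_motion
begin

text \<open>The inductive step for the bound by \<open>cw_g\<close>. Outside the interval the mean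
  does not change, by the martingale property. Inside, the bound is interpolated between the
  endpoints, or continued from one endpoint if the other is infinite.\<close>

lemma expectation_abs_stop_at_exit:
  fixes p q c :: real and g :: "real \<Rightarrow> real"
  defines "a \<equiv> Inf (ereal ` {x. p * x + q < g x})" and "b \<equiv> Sup (ereal ` {x. p * x + q < g x})"
  assumes \<sigma>: "stopping_time F \<sigma>" and \<tau>: "stopping_time F \<tau>"
    and \<tau>_eq: "\<And>\<omega>. \<tau> \<omega> = hit_after \<sigma> {x. ereal x \<notin> {a<..<b}} \<omega>"
    and p: "\<bar>p\<bar> \<le> 1" and g: "continuous_on UNIV g" "\<And>x. g x \<le> c - \<bar>x\<bar>"
    and IH: "\<And>z. expectation (\<lambda>\<omega>. \<bar>stop_at N \<sigma> \<omega> - z\<bar>) \<le> - g z"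
  shows "expectation (\<lambda>\<omega>. \<bar>stop_at N \<tau> \<omega> - z\<bar>) \<le> - min (g z) (p * z + q)"
proof -
  let ?U = "{x. p * x + q < g x}"
  let ?G = "\<lambda>z. expectation (\<lambda>\<omega>. \<bar>stop_at N \<tau> \<omega> - z\<bar>)"
  have int: "integrable M (stop_at N \<sigma>)" "integrable M (stop_at N \<tau>)"
    using integrable_stop_at \<sigma> \<tau> by auto
  have path: "stop_at N \<tau> \<omega> = stop_at N \<sigma> \<omega> \<or>
    (a \<le> ereal (stop_at N \<sigma> \<omega>) \<and> ereal (stop_at N \<sigma> \<omega>) \<le> b \<and> a \<le> ereal (stop_at N \<tau> \<omega>) \<and> ereal (stop_at N \<tau> \<omega>) \<le> b)"
    if "\<omega> \<in> space M" for \<omega>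
    using stop_at_exit_interval[OF that, of N \<sigma> a b] \<tau>_eq by (simp add: stop_at_def)
  have mean: "expectation (stop_at N \<sigma>) = expectation (stop_at N \<tau>)"
    by (simp add: expectation_stop_at \<sigma> \<tau>)
  have outside: "?G z \<le> - g z" if z: "ereal z \<le> a \<or> b \<le> ereal z" for z
  proof -
    \<comment> \<open>\<open>e\<close> is the slope of \<open>\<bar>x - z\<bar>\<close> on the
      closed interval. The correction term has mean 0 because the two stopped values have equal
      means.\<close>
    define e :: real where "e = (if ereal z \<le> a then 1 else - 1)"
    have "?G z = expectation (\<lambda>\<omega>. \<bar>stop_at N \<sigma> \<omega> - z\<bar> + e * (stop_at N \<tau> \<omega> - stop_at N \<sigma> \<omega>))"
    proof (rule Bochner_Integration.integral_cong[OF refl])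
      fix \<omega> assume "\<omega> \<in> space M"
      from path[OF this] show "\<bar>stop_at N \<tau> \<omega> - z\<bar> = \<bar>stop_at N \<sigma> \<omega> - z\<bar> + e * (stop_at N \<tau> \<omega> - stop_at N \<sigma> \<omega>)"
      proof
        assume *: "a \<le> ereal (stop_at N \<sigma> \<omega>) \<and> ereal (stop_at N \<sigma> \<omega>) \<le> b \<and> a \<le> ereal (stop_at N \<tau> \<omega>) \<and> ereal (stop_at N \<tau> \<omega>) \<le> b"
        show ?thesis
        proof (cases "ereal z \<le> a")
          case True
          then have "ereal z \<le> ereal (stop_at N \<sigma> \<omega>)" "ereal z \<le> ereal (stop_at N \<tau> \<omega>)"
            using * order_trans by blast+
          with True show ?thesis by (simp add: e_def)
        next
          case False
          with z have "b \<le> ereal z" by simp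
          then have "ereal (stop_at N \<sigma> \<omega>) \<le> ereal z" "ereal (stop_at N \<tau> \<omega>) \<le> ereal z"
            using * order_trans by blast+
          with False show ?thesis by (simp add: e_def)
        qed
      qed simp
    qed
    also have "\<dots> = expectation (\<lambda>\<omega>. \<bar>stop_at N \<sigma> \<omega> - z\<bar>)"
      using int mean by simp
    finally show ?thesis using IH[of z] by simp
  qed
  have closed_U: "closure ?U \<subseteq> {x. p * x + q \<le> g x}"
    by (rule closure_minimal) (auto intro!: closed_Collect_le continuous_intros g)
  have Ga: "?G a' \<le> - (p * a' + q)" if "a = ereal a'" for a'
    using outside[of a'] closed_U Inf_ereal_image_in_closure[of a' ?U] that unfolding a_def by fastforce
  have Gb: "?G b' \<le> - (p * b' + q)" if "b = ereal b'" for b'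
    using outside[of b'] closed_U Sup_ereal_image_in_closure[of b' ?U] that unfolding b_def by fastforce
  have inside: "?G z \<le> - (p * z + q)" if z: "a < ereal z" "ereal z < b"
  proof -
    \<comment> \<open>If one endpoint is infinite, the slope of the affine function has modulus 1
      and its negative rises, away from the finite endpoint, exactly as fast as the 1-Lipschitz
      function \<open>?G\<close> may.\<close>
    have lip: "?G z \<le> ?G y + \<bar>y - z\<bar>" for y
    proof -
      have "?G z \<le> expectation (\<lambda>\<omega>. \<bar>stop_at N \<tau> \<omega> - y\<bar> + \<bar>y - z\<bar>)"
        by (rule integral_mono) (use int in auto)
      also have "\<dots> = ?G y + \<bar>y - z\<bar>" using int by (simp add: prob_space)
      finally show ?thesis .
    qed
    show ?thesis
    proof (cases a)
      case (real a')
      show ?thesis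
      proof (cases b)
        case (real b')
        have ab: "a' < z" "z < b'" using z \<open>a = ereal a'\<close> real by auto
        define l where "l = (b' - z) / (b' - a')"
        have l: "0 \<le> l" "0 \<le> 1 - l" "1 - l = (z - a') / (b' - a')"
          using ab by (auto simp: l_def field_simps)
        have "l * (b' - a') = b' - z" using ab by (simp add: l_def)
        have cv: "\<bar>x - z\<bar> \<le> l * \<bar>x - a'\<bar> + (1 - l) * \<bar>x - b'\<bar>" for x
          using interval_abs_convex[OF ab, of x] unfolding l(3) unfolding l_def .
        from \<open>l * (b' - a') = b' - z\<close> have lz: "l * a' + (1 - l) * b' = z" by (simp add: algebra_simps)
        have "?G z \<le> expectation (\<lambda>\<omega>. l * \<bar>stop_at N \<tau> \<omega> - a'\<bar> + (1 - l) * \<bar>stop_at N \<tau> \<omega> - b'\<bar>)"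
          by (rule integral_mono) (use int cv in auto)
        also have "\<dots> = l * ?G a' + (1 - l) * ?G b'" using int by simp
        also have "\<dots> \<le> l * - (p * a' + q) + (1 - l) * - (p * b' + q)"
          using Ga[OF \<open>a = ereal a'\<close>] Gb[OF real] l by (intro add_mono mult_left_mono) auto
        also have "\<dots> = - (p * (l * a' + (1 - l) * b') + q)" by (simp add: algebra_simps)
        finally show ?thesis unfolding lz .
      next
        case PInf
        then have "p = - 1" using p g(2) by (intro slope_minus_one_if_below_at_top[of p q g c]) (auto simp: b_def)
        with Ga[OF real] lip[of a'] z(1) real show ?thesis by simp
      qed (use z in simp)
    next
      case MInf
      then have p1: "p = 1" using p g(2) by (intro slope_one_if_below_at_bot[of p q g c]) (auto simp: a_def)
      show ?thesis
      proof (cases b)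
        case (real b')
        with Gb[OF real] lip[of b'] z(2) p1 show ?thesis by simp
      next
        case PInf
        then have "p = - 1" using p g(2) by (intro slope_minus_one_if_below_at_top[of p q g c]) (auto simp: b_def)
        \<comment> \<open>Two infinite endpoints would force both slopes 1 and -1, so this case
          cannot occur.\<close>
        with p1 show ?thesis by simp
      qed (use z in simp)
    qed (use z in simp)
  qed
  show ?thesis
  proof (cases "a < ereal z \<and> ereal z < b")
    case True
    then show ?thesis using inside by auto
  next
    case False
    then have "ereal z \<le> a \<or> b \<le> ereal z" by auto
    then show ?thesis using outside[of z] by auto
  qed
qed

end

text \<open>Up to constants a potential is \<open>- \<bar>x\<bar>\<close>. The upper bound controls
  the slopes at infinite endpoints, both bounds together make the supremum \<open>C\<close> finite,
  and the Lipschitz bound gives continuity of \<open>cw_g\<close>.\<close>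

lemma potential_le:
  assumes "prob_space \<nu>" and [measurable_cong]: "sets \<nu> = sets borel" and i: "integrable \<nu> (\<lambda>x. \<bar>x\<bar>)"
  shows "potential \<nu> x \<le> (\<integral>y. \<bar>y\<bar> \<partial>\<nu>) - \<bar>x\<bar>"
    and "- \<bar>x\<bar> - (\<integral>y. \<bar>y\<bar> \<partial>\<nu>) \<le> potential \<nu> x"
    and "\<bar>potential \<nu> x - potential \<nu> x'\<bar> \<le> \<bar>x - x'\<bar>"
proof -
  interpret prob_space \<nu> by fact
  have m: "(\<lambda>y. y) \<in> borel_measurable \<nu>" by (simp add: measurable_ident_sets assms)
  then have i1: "integrable \<nu> (\<lambda>y. y)" using i by (simp add: integrable_abs_iff)
  have i2: "integrable \<nu> (\<lambda>y. \<bar>x - y\<bar>)" for x using i1 by auto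
  have "expectation (\<lambda>y. \<bar>x\<bar> - \<bar>y\<bar>) \<le> expectation (\<lambda>y. \<bar>x - y\<bar>)"
    by (rule integral_mono) (use i1 i2 in auto)
  then show "potential \<nu> x \<le> (\<integral>y. \<bar>y\<bar> \<partial>\<nu>) - \<bar>x\<bar>"
    using i by (simp add: potential_def prob_space)
  have "expectation (\<lambda>y. \<bar>x - y\<bar>) \<le> expectation (\<lambda>y. \<bar>x\<bar> + \<bar>y\<bar>)"
    by (rule integral_mono) (use i1 i2 in auto)
  then show "- \<bar>x\<bar> - (\<integral>y. \<bar>y\<bar> \<partial>\<nu>) \<le> potential \<nu> x"
    using i by (simp add: potential_def prob_space)
  have le: "expectation (\<lambda>y. \<bar>x - y\<bar>) \<le> expectation (\<lambda>y. \<bar>x' - y\<bar>) + \<bar>x - x'\<bar>" for x x'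
  proof -
    have "expectation (\<lambda>y. \<bar>x - y\<bar>) \<le> expectation (\<lambda>y. \<bar>x' - y\<bar> + \<bar>x - x'\<bar>)"
      by (rule integral_mono) (use i1 i2 in auto)
    also have "\<dots> = expectation (\<lambda>y. \<bar>x' - y\<bar>) + \<bar>x - x'\<bar>" using i2 by (simp add: prob_space)
    finally show ?thesis .
  qed
  from le[of x x'] le[of x' x] show "\<bar>potential \<nu> x - potential \<nu> x'\<bar> \<le> \<bar>x - x'\<bar>"
    by (simp add: potential_def abs_le_iff abs_minus_commute)
qed

theorem theorem6p1:
  fixes M :: "'a measure" and F :: "ennreal \<Rightarrow> 'a measure" and B :: "real \<Rightarrow> 'a \<Rightarrow> real"
    and \<mu>0 \<mu> :: "real measure" and f :: "nat \<Rightarrow> real \<Rightarrow> real" and C :: real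
    and T :: "'a \<Rightarrow> ennreal"
  assumes "real_distribution \<mu>0" and "integrable \<mu>0 (\<lambda>x. \<bar>x\<bar>)"
    and "real_distribution \<mu>" and "integrable \<mu> (\<lambda>x. \<bar>x\<bar>)"
    and "brownian_motion M F B"
    and "distr M borel (B 0) = \<mu>0"
    and "C = (SUP x. potential \<mu> x - potential \<mu>0 x)"
    and "\<And>n. n \<ge> 1 \<Longrightarrow> \<exists>p q. f n = (\<lambda>x. p * x + q)"
    and "\<And>n x. n \<ge> 1 \<Longrightarrow> \<bar>deriv (f n) x\<bar> \<le> 1"
    and "\<And>x. min (INF n\<in>{1..}. ereal (f n x)) (ereal (potential \<mu>0 x)) = ereal (potential \<mu> x - C)"
    and "T = (\<lambda>\<omega>. lim (\<lambda>n. cw_T \<mu>0 f B n \<omega>))"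
  shows "minimal_stopping_time M F B T"
proof -
  interpret brownian_motion M F B by fact
  interpret \<mu>0: real_distribution \<mu>0 by fact
  interpret \<mu>: real_distribution \<mu> by fact
  have B0[measurable]: "B 0 \<in> borel_measurable M" by (rule measurable_B) simp
  have int0: "integrable M (B 0)"
  proof -
    have "integrable M (\<lambda>\<omega>. \<bar>B 0 \<omega>\<bar>)"
      using assms(2) unfolding assms(6)[symmetric] by (subst (asm) integrable_distr_eq) auto
    then show ?thesis by (simp add: integrable_abs_iff)
  qed
  interpret integrable_brownian_motion M F B by unfold_locales (fact int0)
  note pot0 = potential_le[OF \<mu>0.prob_space_axioms \<mu>0.events_eq_borel assms(2)]
    and pot = potential_le[OF \<mu>.prob_space_axioms \<mu>.events_eq_borel assms(4)]
  have pot0_eq: "potential \<mu>0 z = - expectation (\<lambda>\<omega>. \<bar>B 0 \<omega> - z\<bar>)" for z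
    unfolding potential_def assms(6)[symmetric] by (subst integral_distr) (auto simp: abs_minus_commute)
  let ?\<tau> = "cw_T \<mu>0 f B" and ?g = "cw_g \<mu>0 f"
  have affine: "\<exists>p q. f (Suc n) = (\<lambda>x. p * x + q) \<and> \<bar>p\<bar> \<le> 1" for n
  proof -
    obtain p q where pq: "f (Suc n) = (\<lambda>x. p * x + q)" using assms(8)[of "Suc n"] by auto
    have "deriv (f (Suc n)) 0 = p"
      unfolding pq by (rule DERIV_imp_deriv) (auto intro!: derivative_eq_intros)
    with pq assms(9)[of "Suc n" 0] show ?thesis by auto
  qed
  have g_cont: "continuous_on UNIV (?g n)" for n
  proof (induction n)
    case 0
    show ?case
      using pot0(3) by (auto simp: continuous_on_iff dist_real_def intro: le_less_trans)
  next
    case (Suc n)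
    obtain p q where "f (Suc n) = (\<lambda>x. p * x + q)" using affine by blast
    with Suc show ?case by (auto intro!: continuous_on_min continuous_intros)
  qed
  have g_le: "?g n x \<le> (\<integral>y. \<bar>y\<bar> \<partial>\<mu>0) - \<bar>x\<bar>" for n x
    by (induction n) (use pot0(1) in \<open>auto simp: min_le_iff_disj\<close>)
  \<comment> \<open>Each \<open>?g n\<close> is a minimum of finitely many of the functions whose
    overall infimum is \<open>potential \<mu> x - C\<close>.\<close>
  have g_ge: "potential \<mu> x - C \<le> ?g n x" for n x
  proof (induction n)
    case 0
    have "ereal (potential \<mu> x - C) \<le> ereal (potential \<mu>0 x)"
      unfolding assms(10)[symmetric] by (rule min.cobounded2)
    then show ?case by simp
  next
    case (Suc n)
    have "ereal (potential \<mu> x - C) \<le> (INF n\<in>{1..}. ereal (f n x))"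
      unfolding assms(10)[symmetric] by (rule min.cobounded1)
    also have "\<dots> \<le> ereal (f (Suc n) x)" by (rule INF_lower) simp
    finally show ?case using Suc by simp
  qed
  have \<tau>_Suc: "?\<tau> (Suc n) \<omega> = hit_after (?\<tau> n) {x. ereal x \<notin> {cw_a \<mu>0 f (Suc n)<..<cw_b \<mu>0 f (Suc n)}} \<omega>" for n \<omega>
    by (simp add: hit_after_def)
  have closed_D: "closed {x. ereal x \<notin> {a<..<b}}" for a b :: ereal
  proof -
    have "open {x. a < ereal x \<and> ereal x < b}"
      by (intro open_Collect_conj open_Collect_less continuous_intros)
    moreover have "- {x. a < ereal x \<and> ereal x < b} = {x. ereal x \<notin> {a<..<b}}" by auto
    ultimately show ?thesis by (metis closed_Compl)
  qed
  have \<tau>: "stopping_time F (?\<tau> n)" for n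
  proof (induction n)
    case 0
    show ?case using stopping_time_const[of F 0] by simp
  next
    case (Suc n)
    from stopping_time_hit_after[OF this closed_D] show ?case
      using \<tau>_Suc by (simp add: fun_eq_iff[symmetric])
  qed
  have mono: "incseq (\<lambda>n. ?\<tau> n \<omega>)" for \<omega>
    unfolding incseq_Suc_iff \<tau>_Suc using hit_after_ge by blast
  \<comment> \<open>The sequence increases, so the \<open>lim\<close> that defines \<open>T\<close>
    is a genuine limit and equals the supremum.\<close>
  have lim: "(\<lambda>n. ?\<tau> n \<omega>) \<longlonglongrightarrow> T \<omega>" and T_eq: "T \<omega> = (SUP n. ?\<tau> n \<omega>)" for \<omega>
    using LIMSEQ_SUP[OF mono[of \<omega>]] limI[OF LIMSEQ_SUP[OF mono[of \<omega>]]] assms(11) by auto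
  have T: "stopping_time F T"
  proof
    fix t
    have "T \<omega> \<le> t \<longleftrightarrow> (\<forall>n. ?\<tau> n \<omega> \<le> t)" for \<omega> unfolding T_eq by (auto simp: SUP_le_iff)
    then show "Measurable.pred (F t) (\<lambda>\<omega>. T \<omega> \<le> t)"
      using stopping_timeD[OF \<tau>] by (simp add: pred_intros_countable)
  qed
  have bound_n: "expectation (\<lambda>\<omega>. \<bar>stop_at N (?\<tau> n) \<omega> - z\<bar>) \<le> - ?g n z" for N n z
  proof (induction n arbitrary: z)
    case 0
    show ?case by (simp add: pot0_eq)
  next
    case (Suc n)
    obtain p q where pq: "f (Suc n) = (\<lambda>x. p * x + q)" "\<bar>p\<bar> \<le> 1" using affine by blast
    have "expectation (\<lambda>\<omega>. \<bar>stop_at N (?\<tau> (Suc n)) \<omega> - z\<bar>) \<le> - min (?g n z) (p * z + q)"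
      by (rule expectation_abs_stop_at_exit[OF \<tau> \<tau> _ pq(2) g_cont g_le Suc])
        (simp add: \<tau>_Suc cw_a_def cw_b_def pq(1) del: cw_T.simps)
    then show ?case by (simp add: pq(1))
  qed
  \<comment> \<open>The bound for \<open>?\<tau> n\<close> is relaxed to one independent of
    \<open>n\<close>, and Fatou's lemma carries it to \<open>T\<close>.\<close>
  have bound: "expectation (\<lambda>\<omega>. \<bar>stop_at N T \<omega> - z\<bar>) \<le> C - potential \<mu> z" for N z
  proof (rule integral_le_of_tendsto(2))
    show "integrable M (\<lambda>\<omega>. \<bar>stop_at N (?\<tau> n) \<omega> - z\<bar>)" for n
      using integrable_stop_at[OF \<tau>] by auto
    show "(\<lambda>n. \<bar>stop_at N (?\<tau> n) \<omega> - z\<bar>) \<longlonglongrightarrow> \<bar>stop_at N T \<omega> - z\<bar>" if "\<omega> \<in> space M" for \<omega>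
      by (intro tendsto_intros tendsto_stop_at that lim)
    show "expectation (\<lambda>\<omega>. \<bar>stop_at N (?\<tau> n) \<omega> - z\<bar>) \<le> C - potential \<mu> z" for n
      using bound_n[of N n z] g_ge[of z n] by linarith
  qed simp
  show ?thesis
  proof (rule minimal_stopping_timeI[OF T])
    show "AE \<omega> in M. T \<omega> < \<infinity>"
      using bound[of _ 0] by (intro AE_finite_of_bounded[OF T, of "C - potential \<mu> 0"]) simp
    fix \<delta> :: real assume \<delta>: "0 < \<delta>"
    \<comment> \<open>Over the reals \<open>SUP\<close> is a least upper bound only if the range is
      bounded above; here the two terms \<open>- \<bar>x\<bar>\<close> cancel.\<close>
    have bdd: "bdd_above (range (\<lambda>x. potential \<mu> x - potential \<mu>0 x))"
    proof (rule bdd_aboveI)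
      fix y assume "y \<in> range (\<lambda>x. potential \<mu> x - potential \<mu>0 x)"
      then obtain x where "y = potential \<mu> x - potential \<mu>0 x" by auto
      then show "y \<le> (\<integral>y. \<bar>y\<bar> \<partial>\<mu>) + (\<integral>y. \<bar>y\<bar> \<partial>\<mu>0)" using pot(1)[of x] pot0(2)[of x] by linarith
    qed
    have "C - \<delta> < (SUP x. potential \<mu> x - potential \<mu>0 x)" using assms(7) \<delta> by simp
    \<comment> \<open>A point at which the supremum \<open>C\<close> is reached up to \<delta>; the
      supremum need not be attained.\<close>
    then obtain z where "C - \<delta> < potential \<mu> z - potential \<mu>0 z"
      using bdd by (auto simp: less_cSUP_iff)
    then have "C - potential \<mu> z \<le> expectation (\<lambda>\<omega>. \<bar>B 0 \<omega> - z\<bar>) + \<delta>"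
      using pot0_eq[of z] by linarith
    then show "\<exists>z. \<forall>N. expectation (\<lambda>\<omega>. \<bar>stop_at N T \<omega> - z\<bar>) \<le> expectation (\<lambda>\<omega>. \<bar>B 0 \<omega> - z\<bar>) + \<delta>"
      using bound order_trans by blast
  qed
qed

end
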